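(* Let $M_1$, $M_2$ be preGarside monoids, and let $N$ be a common parabolic submonoid. Then the amalgamated product $M = M_1*_NM_2$ is a preGarside monoid.
   Context: For a monoid $M$: $b\preceq_L a$ means $a=bc$ for some $c\in M$; $c\preceq_R a$ means $a=bc$ for some $b\in M$. $M$ is cancellative if $cad=cbd$ implies $a=b$. $M$ is atomic if there is a map $\nu:M\to\mathbb{N}$ with $\nu(a)>0$ for $a\ne 1$ and $\nu(ab)\ge\nu(a)+\nu(b)$. A preGarside monoid is a cancellative atomic monoid $M$ such that, for all $a,b\in M$, if $a,b$ have a common upper bound for $\preceq_L$ then they have a least one, $a\vee_L b$, and if they have a common upper bound for $\preceq_R$ then they have a least one, $a\vee_R b$. A submonoid $N$ of a preGarside monoid $M$ is (standard) parabolic if (i) $ab\in N$ implies $a,b\in N$ for all $a,b\in M$; and (ii) for all $a,b\in N$, $a\vee_L b\in N$ whenever it exists in $M$, and $a\vee_R b\in N$ whenever it exists in $M$. "$N$ is a common parabolic submonoid of $M_1$ and $M_2$" means that injective monoid morphisms $\iota_i:N\to M_i$ are given with $\iota_i(N)$ parabolic in $M_i$ for $i=1,2$. $M_1*_NM_2$ is the amalgamated product, i.e. the pushout of $\iota_1,\iota_2$ in the category of monoids. *)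

theory Defs
  imports "HOL-Algebra.Divisibility"
begin

text \<open>
  Left divisibility \<open>b \<preceq>\<^sub>L a\<close> (\<open>a = b c\<close> for some \<open>c\<close>) is literally the relation
  \<open>b divides\<^bsub>G\<^esub> a\<close> of HOL-Algebra, and a least common upper bound for \<open>\<preceq>\<^sub>L\<close> is an element
  of the carrier satisfying \<open>lcmof\<close>. HOL-Algebra has no mirror images of these two notions.
\<close>

definition right_divides :: "[_, 'a, 'a] \<Rightarrow> bool" (infix \<open>rdivides\<index>\<close> 65)
  where "c rdivides\<^bsub>G\<^esub> a \<longleftrightarrow> (\<exists>b\<in>carrier G. a = b \<otimes>\<^bsub>G\<^esub> c)"

definition is_left_join :: "[_, 'a, 'a, 'a] \<Rightarrow> bool"
  where "is_left_join G a b s \<longleftrightarrow> s \<in> carrier G \<and> s lcmof\<^bsub>G\<^esub> a b"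

definition is_right_join :: "[_, 'a, 'a, 'a] \<Rightarrow> bool"
  where "is_right_join G a b s \<longleftrightarrow>
    s \<in> carrier G \<and> a rdivides\<^bsub>G\<^esub> s \<and> b rdivides\<^bsub>G\<^esub> s \<and>
    (\<forall>y\<in>carrier G. a rdivides\<^bsub>G\<^esub> y \<and> b rdivides\<^bsub>G\<^esub> y \<longrightarrow> s rdivides\<^bsub>G\<^esub> y)"

locale cancellative_monoid = monoid +
  assumes cancel:
    "\<lbrakk>c \<otimes> a \<otimes> d = c \<otimes> b \<otimes> d; a \<in> carrier G; b \<in> carrier G; c \<in> carrier G; d \<in> carrier G\<rbrakk>
      \<Longrightarrow> a = b"

locale atomic_monoid = monoid +
  assumes ex_norm:
    "\<exists>\<nu> :: 'a \<Rightarrow> nat. (\<forall>a\<in>carrier G. a \<noteq> \<one> \<longrightarrow> \<nu> a > 0) \<and>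
      (\<forall>a\<in>carrier G. \<forall>b\<in>carrier G. \<nu> (a \<otimes> b) \<ge> \<nu> a + \<nu> b)"

locale preGarside_monoid = cancellative_monoid + atomic_monoid +
  assumes ex_left_join:
    "\<lbrakk>a \<in> carrier G; b \<in> carrier G; \<exists>m\<in>carrier G. a divides m \<and> b divides m\<rbrakk>
      \<Longrightarrow> \<exists>s. is_left_join G a b s"
    and ex_right_join:
    "\<lbrakk>a \<in> carrier G; b \<in> carrier G; \<exists>m\<in>carrier G. a rdivides m \<and> b rdivides m\<rbrakk>
      \<Longrightarrow> \<exists>s. is_right_join G a b s"

locale parabolic_submonoid = submonoid H G for H and G (structure) +
  assumes factors_closed:
    "\<lbrakk>a \<in> carrier G; b \<in> carrier G; a \<otimes> b \<in> H\<rbrakk> \<Longrightarrow> a \<in> H \<and> b \<in> H"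
    and left_join_closed: "\<lbrakk>a \<in> H; b \<in> H; is_left_join G a b s\<rbrakk> \<Longrightarrow> s \<in> H"
    and right_join_closed: "\<lbrakk>a \<in> H; b \<in> H; is_right_join G a b s\<rbrakk> \<Longrightarrow> s \<in> H"

text \<open>The set \<open>hom\<close> of HOL-Algebra does not require preservation of the unit.\<close>

definition monoid_hom :: "_ \<Rightarrow> _ \<Rightarrow> ('a \<Rightarrow> 'b) set"
  where "monoid_hom G H = {h \<in> hom G H. h \<one>\<^bsub>G\<^esub> = \<one>\<^bsub>H\<^esub>}"

text \<open>
  The amalgamated product is presented by the elements of both monoids: words over the disjoint
  union of the carriers, modulo the monoid congruence generated by the multiplication tables of
  \<open>M\<^sub>1\<close> and \<open>M\<^sub>2\<close> and by \<open>\<iota>\<^sub>1(n) = \<iota>\<^sub>2(n)\<close>. Lemmas \<open>amalgamated_product_cocone\<close> and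
  \<open>amalgamated_product_universal\<close> below show that this is the pushout.
\<close>

definition amalgam_words :: "('a, 'x) monoid_scheme \<Rightarrow> ('b, 'y) monoid_scheme \<Rightarrow> ('a + 'b) list set"
  where "amalgam_words M1 M2 = lists (carrier M1 <+> carrier M2)"

inductive_set amalgam_cong ::
    "('n, 'z) monoid_scheme \<Rightarrow> ('n \<Rightarrow> 'a) \<Rightarrow> ('a, 'x) monoid_scheme \<Rightarrow>
     ('n \<Rightarrow> 'b) \<Rightarrow> ('b, 'y) monoid_scheme \<Rightarrow> (('a + 'b) list \<times> ('a + 'b) list) set"
  for N i1 M1 i2 M2
  where
    refl: "u \<in> amalgam_words M1 M2 \<Longrightarrow> (u, u) \<in> amalgam_cong N i1 M1 i2 M2"
  | sym: "(u, v) \<in> amalgam_cong N i1 M1 i2 M2 \<Longrightarrow> (v, u) \<in> amalgam_cong N i1 M1 i2 M2"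
  | trans: "\<lbrakk>(u, v) \<in> amalgam_cong N i1 M1 i2 M2; (v, w) \<in> amalgam_cong N i1 M1 i2 M2\<rbrakk>
      \<Longrightarrow> (u, w) \<in> amalgam_cong N i1 M1 i2 M2"
  | append: "\<lbrakk>(u, u') \<in> amalgam_cong N i1 M1 i2 M2; (v, v') \<in> amalgam_cong N i1 M1 i2 M2\<rbrakk>
      \<Longrightarrow> (u @ v, u' @ v') \<in> amalgam_cong N i1 M1 i2 M2"
  | one1: "([Inl \<one>\<^bsub>M1\<^esub>], []) \<in> amalgam_cong N i1 M1 i2 M2"
  | one2: "([Inr \<one>\<^bsub>M2\<^esub>], []) \<in> amalgam_cong N i1 M1 i2 M2"
  | mult1: "\<lbrakk>x \<in> carrier M1; y \<in> carrier M1\<rbrakk>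
      \<Longrightarrow> ([Inl x, Inl y], [Inl (x \<otimes>\<^bsub>M1\<^esub> y)]) \<in> amalgam_cong N i1 M1 i2 M2"
  | mult2: "\<lbrakk>x \<in> carrier M2; y \<in> carrier M2\<rbrakk>
      \<Longrightarrow> ([Inr x, Inr y], [Inr (x \<otimes>\<^bsub>M2\<^esub> y)]) \<in> amalgam_cong N i1 M1 i2 M2"
  | amalgam: "n \<in> carrier N \<Longrightarrow> ([Inl (i1 n)], [Inr (i2 n)]) \<in> amalgam_cong N i1 M1 i2 M2"

definition amalgamated_product ::
    "('n, 'z) monoid_scheme \<Rightarrow> ('n \<Rightarrow> 'a) \<Rightarrow> ('a, 'x) monoid_scheme \<Rightarrow>
     ('n \<Rightarrow> 'b) \<Rightarrow> ('b, 'y) monoid_scheme \<Rightarrow> ('a + 'b) list set monoid"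
  where "amalgamated_product N i1 M1 i2 M2 =
    \<lparr>carrier = amalgam_words M1 M2 // amalgam_cong N i1 M1 i2 M2,
     monoid.mult = (\<lambda>A B. \<Union>u\<in>A. \<Union>v\<in>B. amalgam_cong N i1 M1 i2 M2 `` {u @ v}),
     one = amalgam_cong N i1 M1 i2 M2 `` {[]}\<rparr>"

definition amalgam_inj1 ::
    "('n, 'z) monoid_scheme \<Rightarrow> ('n \<Rightarrow> 'a) \<Rightarrow> ('a, 'x) monoid_scheme \<Rightarrow>
     ('n \<Rightarrow> 'b) \<Rightarrow> ('b, 'y) monoid_scheme \<Rightarrow> 'a \<Rightarrow> ('a + 'b) list set"
  where "amalgam_inj1 N i1 M1 i2 M2 x = amalgam_cong N i1 M1 i2 M2 `` {[Inl x]}"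

definition amalgam_inj2 ::
    "('n, 'z) monoid_scheme \<Rightarrow> ('n \<Rightarrow> 'a) \<Rightarrow> ('a, 'x) monoid_scheme \<Rightarrow>
     ('n \<Rightarrow> 'b) \<Rightarrow> ('b, 'y) monoid_scheme \<Rightarrow> 'b \<Rightarrow> ('a + 'b) list set"
  where "amalgam_inj2 N i1 M1 i2 M2 y = amalgam_cong N i1 M1 i2 M2 `` {[Inr y]}"

locale amalgam_data =
  N: monoid N + M1: monoid M1 + M2: monoid M2
  for N :: "('n, 'z) monoid_scheme" and M1 :: "('a, 'x) monoid_scheme"
    and M2 :: "('b, 'y) monoid_scheme" +
  fixes i1 :: "'n \<Rightarrow> 'a" and i2 :: "'n \<Rightarrow> 'b"
  assumes i1: "i1 \<in> monoid_hom N M1" and i2: "i2 \<in> monoid_hom N M2"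
begin

abbreviation "W \<equiv> amalgam_words M1 M2"
abbreviation "C \<equiv> amalgam_cong N i1 M1 i2 M2"
abbreviation "P \<equiv> amalgamated_product N i1 M1 i2 M2"
abbreviation "j1 \<equiv> amalgam_inj1 N i1 M1 i2 M2"
abbreviation "j2 \<equiv> amalgam_inj2 N i1 M1 i2 M2"

lemma i1_closed: "n \<in> carrier N \<Longrightarrow> i1 n \<in> carrier M1"
  using i1 by (auto simp: monoid_hom_def hom_def)

lemma i2_closed: "n \<in> carrier N \<Longrightarrow> i2 n \<in> carrier M2"
  using i2 by (auto simp: monoid_hom_def hom_def)

lemma append_words: "\<lbrakk>u \<in> W; v \<in> W\<rbrakk> \<Longrightarrow> u @ v \<in> W"
  by (simp add: amalgam_words_def)

lemma cong_words: "(u, v) \<in> C \<Longrightarrow> u \<in> W \<and> v \<in> W"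
  by (induction rule: amalgam_cong.induct) (auto simp: amalgam_words_def i1_closed i2_closed)

lemma equiv_cong: "equiv W C"
proof (rule equivI)
  show "C \<subseteq> W \<times> W" using cong_words by auto
  show "refl_on W C" by (rule refl_onI) (rule amalgam_cong.refl)
  show "sym C" by (rule symI) (rule amalgam_cong.sym)
  show "trans C" by (rule transI) (rule amalgam_cong.trans)
qed

lemma class_eq_iff: "\<lbrakk>u \<in> W; v \<in> W\<rbrakk> \<Longrightarrow> C `` {u} = C `` {v} \<longleftrightarrow> (u, v) \<in> C"
  by (rule eq_equiv_class_iff[OF equiv_cong])

lemma class_closed: "u \<in> W \<Longrightarrow> C `` {u} \<in> carrier P"
  by (simp add: amalgamated_product_def quotientI)

lemma carrierE:
  assumes "A \<in> carrier P" obtains u where "u \<in> W" "A = C `` {u}"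
  using assms by (auto simp: amalgamated_product_def elim: quotientE)

lemma one_eq: "\<one>\<^bsub>P\<^esub> = C `` {[]}"
  by (simp add: amalgamated_product_def)

lemma mult_class:
  assumes "u \<in> W" "v \<in> W"
  shows "C `` {u} \<otimes>\<^bsub>P\<^esub> C `` {v} = C `` {u @ v}"
proof -
  have "C `` {u' @ v'} = C `` {u @ v}" if "u' \<in> C `` {u}" "v' \<in> C `` {v}" for u' v'
    by (rule equiv_class_eq[OF equiv_cong amalgam_cong.sym[OF amalgam_cong.append]])
       (use that in simp_all)
  moreover have "u \<in> C `` {u}" "v \<in> C `` {v}"
    using assms by (simp_all add: amalgam_cong.refl)
  ultimately have "(\<Union>u'\<in>C `` {u}. \<Union>v'\<in>C `` {v}. C `` {u' @ v'}) = C `` {u @ v}"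
    by fast
  then show ?thesis
    by (simp add: amalgamated_product_def)
qed

lemma monoid_amalgamated_product: "monoid P"
proof (rule monoidI)
  have nil: "[] \<in> W" by (simp add: amalgam_words_def)
  show "\<one>\<^bsub>P\<^esub> \<in> carrier P" by (simp add: one_eq class_closed nil)
  fix A assume "A \<in> carrier P"
  then obtain u where u: "u \<in> W" "A = C `` {u}" by (rule carrierE)
  show "\<one>\<^bsub>P\<^esub> \<otimes>\<^bsub>P\<^esub> A = A" "A \<otimes>\<^bsub>P\<^esub> \<one>\<^bsub>P\<^esub> = A"
    using u nil by (simp_all add: one_eq mult_class)
  fix B assume "B \<in> carrier P"
  then obtain v where v: "v \<in> W" "B = C `` {v}" by (rule carrierE)
  show "A \<otimes>\<^bsub>P\<^esub> B \<in> carrier P"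
    using u v by (simp add: mult_class class_closed append_words)
  fix D assume "D \<in> carrier P"
  then obtain w where w: "w \<in> W" "D = C `` {w}" by (rule carrierE)
  show "A \<otimes>\<^bsub>P\<^esub> B \<otimes>\<^bsub>P\<^esub> D = A \<otimes>\<^bsub>P\<^esub> (B \<otimes>\<^bsub>P\<^esub> D)"
    using u v w by (simp add: mult_class append_words)
qed

lemma inl_word: "x \<in> carrier M1 \<Longrightarrow> [Inl x] \<in> W"
  and inr_word: "y \<in> carrier M2 \<Longrightarrow> [Inr y] \<in> W"
  by (auto simp: amalgam_words_def)

lemma amalgamated_product_cocone:
  "j1 \<in> monoid_hom M1 P" "j2 \<in> monoid_hom M2 P"
  "n \<in> carrier N \<Longrightarrow> j1 (i1 n) = j2 (i2 n)"
proof -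
  have nil: "[] \<in> W" by (simp add: amalgam_words_def)
  show "j1 \<in> monoid_hom M1 P"
  proof -
    have "j1 (x \<otimes>\<^bsub>M1\<^esub> y) = j1 x \<otimes>\<^bsub>P\<^esub> j1 y" if "x \<in> carrier M1" "y \<in> carrier M1" for x y
    proof -
      have "C `` {[Inl x, Inl y]} = C `` {[Inl (x \<otimes>\<^bsub>M1\<^esub> y)]}"
        by (rule equiv_class_eq[OF equiv_cong amalgam_cong.mult1[OF that]])
      then show ?thesis
        using that by (simp add: amalgam_inj1_def mult_class inl_word)
    qed
    moreover have "j1 \<one>\<^bsub>M1\<^esub> = \<one>\<^bsub>P\<^esub>"
      unfolding amalgam_inj1_def one_eq by (rule equiv_class_eq[OF equiv_cong amalgam_cong.one1])
    ultimately show ?thesis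
      by (auto simp: monoid_hom_def hom_def amalgam_inj1_def class_closed inl_word)
  qed
  show "j2 \<in> monoid_hom M2 P"
  proof -
    have "j2 (x \<otimes>\<^bsub>M2\<^esub> y) = j2 x \<otimes>\<^bsub>P\<^esub> j2 y" if "x \<in> carrier M2" "y \<in> carrier M2" for x y
    proof -
      have "C `` {[Inr x, Inr y]} = C `` {[Inr (x \<otimes>\<^bsub>M2\<^esub> y)]}"
        by (rule equiv_class_eq[OF equiv_cong amalgam_cong.mult2[OF that]])
      then show ?thesis
        using that by (simp add: amalgam_inj2_def mult_class inr_word)
    qed
    moreover have "j2 \<one>\<^bsub>M2\<^esub> = \<one>\<^bsub>P\<^esub>"
      unfolding amalgam_inj2_def one_eq by (rule equiv_class_eq[OF equiv_cong amalgam_cong.one2])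
    ultimately show ?thesis
      by (auto simp: monoid_hom_def hom_def amalgam_inj2_def class_closed inr_word)
  qed
  show "j1 (i1 n) = j2 (i2 n)" if "n \<in> carrier N"
    unfolding amalgam_inj1_def amalgam_inj2_def
    by (rule equiv_class_eq[OF equiv_cong amalgam_cong.amalgam[OF that]])
qed

lemma hom_eqI:
  fixes Q :: "('q, 'w) monoid_scheme"
  assumes "f \<in> monoid_hom P Q" "g \<in> monoid_hom P Q"
    and "\<And>x. x \<in> carrier M1 \<Longrightarrow> f (j1 x) = g (j1 x)"
    and "\<And>y. y \<in> carrier M2 \<Longrightarrow> f (j2 y) = g (j2 y)"
    and "A \<in> carrier P"
  shows "f A = g A"
proof -
  have "f (C `` {u}) = g (C `` {u})" if "u \<in> W" for u
    using that
  proof (induction u)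
    case Nil
    then show ?case using assms(1,2) by (simp add: monoid_hom_def flip: one_eq)
  next
    case (Cons a u)
    have a: "[a] \<in> W" and u: "u \<in> W" using Cons.prems by (auto simp: amalgam_words_def)
    have "f (C `` {[a]}) = g (C `` {[a]})"
      using a assms(3,4)
      by (auto simp: amalgam_words_def amalgam_inj1_def amalgam_inj2_def)
    moreover have "C `` {a # u} = C `` {[a]} \<otimes>\<^bsub>P\<^esub> C `` {u}"
      using mult_class[OF a u] by simp
    ultimately show ?case
      using assms(1,2) Cons.IH[OF u] class_closed[OF a] class_closed[OF u]
      by (simp add: monoid_hom_def hom_def)
  qed
  moreover obtain u where "u \<in> W" "A = C `` {u}" using assms(5) by (rule carrierE)
  ultimately show ?thesis by metis
qed

lemma amalgamated_product_universal:
  fixes Q :: "('q, 'w) monoid_scheme"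
  assumes "monoid Q" and f1: "f1 \<in> monoid_hom M1 Q" and f2: "f2 \<in> monoid_hom M2 Q"
    and eq: "\<And>n. n \<in> carrier N \<Longrightarrow> f1 (i1 n) = f2 (i2 n)"
  shows "\<exists>f\<in>monoid_hom P Q.
    (\<forall>x\<in>carrier M1. f (j1 x) = f1 x) \<and> (\<forall>y\<in>carrier M2. f (j2 y) = f2 y) \<and>
    (\<forall>g\<in>monoid_hom P Q.
      (\<forall>x\<in>carrier M1. g (j1 x) = f1 x) \<and> (\<forall>y\<in>carrier M2. g (j2 y) = f2 y) \<longrightarrow>
      (\<forall>A\<in>carrier P. g A = f A))"
proof -
  interpret Q: monoid Q by fact
  define F where "F u = foldr (\<lambda>a q. case_sum f1 f2 a \<otimes>\<^bsub>Q\<^esub> q) u \<one>\<^bsub>Q\<^esub>" for u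
  have Fs: "F [] = \<one>\<^bsub>Q\<^esub>" "F (a # u) = case_sum f1 f2 a \<otimes>\<^bsub>Q\<^esub> F u" for a u
    by (simp_all add: F_def)
  have cl: "f1 x \<in> carrier Q" if "x \<in> carrier M1" for x
    using f1 that by (auto simp: monoid_hom_def hom_def)
  have cl': "f2 x \<in> carrier Q" if "x \<in> carrier M2" for x
    using f2 that by (auto simp: monoid_hom_def hom_def)
  have Fcl: "F u \<in> carrier Q" if "u \<in> W" for u
    using that unfolding amalgam_words_def
    by (induction u) (auto simp: Fs cl cl')
  have Fapp: "F (u @ v) = F u \<otimes>\<^bsub>Q\<^esub> F v" if "u \<in> W" "v \<in> W" for u v
    using that(1)
  proof (induction u)
    case Nil then show ?case using Fcl[OF that(2)] by (simp add: Fs)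
  next
    case (Cons a u)
    then have "u \<in> W" "case_sum f1 f2 a \<in> carrier Q" by (auto simp: amalgam_words_def cl cl')
    then show ?case using Cons.IH Fcl that(2) by (simp add: Fs Q.m_assoc)
  qed
  have Fcong: "F u = F v" if "(u, v) \<in> C" for u v
    using that
  proof (induction rule: amalgam_cong.induct)
    case (append u u' v v')
    then show ?case by (metis Fapp cong_words)
  next
    case (mult1 x y)
    then show ?case using f1 cl by (auto simp: Fs monoid_hom_def hom_def)
  next
    case (mult2 x y)
    then show ?case using f2 cl' by (auto simp: Fs monoid_hom_def hom_def)
  qed (use f1 f2 eq in \<open>auto simp: Fs monoid_hom_def\<close>)
  define f where "f A = F (SOME u. u \<in> A)" for A
  have f_class: "f (C `` {u}) = F u" if "u \<in> W" for u
  proof -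
    have "u \<in> C `` {u}" using that by (auto intro: amalgam_cong.refl)
    then have "(SOME v. v \<in> C `` {u}) \<in> C `` {u}" by (rule someI)
    then have "(u, SOME v. v \<in> C `` {u}) \<in> C" by simp
    then show ?thesis unfolding f_def by (rule Fcong[symmetric])
  qed
  have fhom: "f \<in> monoid_hom P Q"
    unfolding monoid_hom_def hom_def
  proof (safe)
    fix A assume "A \<in> carrier P"
    then obtain u where "u \<in> W" "A = C `` {u}" by (rule carrierE)
    then show "f A \<in> carrier Q" by (simp add: f_class Fcl)
  next
    fix A B assume A: "A \<in> carrier P" and B: "B \<in> carrier P"
    obtain u where "u \<in> W" "A = C `` {u}" using A by (rule carrierE)
    moreover obtain v where "v \<in> W" "B = C `` {v}" using B by (rule carrierE)
    ultimately show "f (A \<otimes>\<^bsub>P\<^esub> B) = f A \<otimes>\<^bsub>Q\<^esub> f B"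
      by (simp add: mult_class f_class append_words Fapp)
  next
    show "f \<one>\<^bsub>P\<^esub> = \<one>\<^bsub>Q\<^esub>" by (simp add: one_eq f_class amalgam_words_def Fs)
  qed
  have fj: "f (j1 x) = f1 x" if "x \<in> carrier M1" for x
    using that by (simp add: amalgam_inj1_def f_class inl_word Fs cl)
  have fj': "f (j2 x) = f2 x" if "x \<in> carrier M2" for x
    using that by (simp add: amalgam_inj2_def f_class inr_word Fs cl')
  show ?thesis
  proof (intro bexI[OF _ fhom] conjI ballI impI)
    fix g A
    assume g: "g \<in> monoid_hom P Q"
      "(\<forall>x\<in>carrier M1. g (j1 x) = f1 x) \<and> (\<forall>y\<in>carrier M2. g (j2 y) = f2 y)"
    assume "A \<in> carrier P"
    then show "g A = f A"
      by (rule hom_eqI[OF g(1) fhom, rotated 2]) (use g(2) fj fj' in simp_all)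
  qed (fact fj fj')+
qed

end

end

theory Submission
  imports Defs
begin

text \<open>
  Write \<open>N\<close> also for its images in \<open>M\<^sub>1\<close> and \<open>M\<^sub>2\<close>. Atomicity bounds the elements of \<open>N\<close> that divide
  a given \<open>x \<in> M\<^sub>i\<close> on the left, and parabolicity lets one join them inside \<open>N\<close>; so there is a
  greatest one, and \<open>x = n r\<close> for a unique \<open>n \<in> N\<close> and a unique reduced \<open>r\<close>, one with no nontrivial
  left divisor in \<open>N\<close> (\<open>reduced_decomposition\<close>, \<open>reduced_decomposition_unique\<close>). Thus each \<open>M\<^sub>i\<close> is a
  free left \<open>N\<close>-set, and as for groups every element of the amalgam \<open>M\<close> is \<open>n r\<^sub>1 \<dots> r\<^sub>k\<close> with \<open>n \<in> N\<close> and
  nontrivial reduced \<open>r\<^sub>j\<close> taken alternately from \<open>M\<^sub>1\<close> and \<open>M\<^sub>2\<close>. Van der Waerden's trick gives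
  uniqueness: both factors act on these normal forms compatibly (\<open>normal_form_action\<close>). Left
  multiplication changes \<open>n\<close> and changes or inserts at most one letter next to it, and no letter ever
  disappears, since a product lying in \<open>N\<close> has its factors in \<open>N\<close>.

  Absorbing the first letter into the coefficient when it belongs to \<open>M\<^sub>i\<close> shows that \<open>M\<close> is a free
  left \<open>M\<^sub>i\<close>-set, with basis the set \<open>T\<^sub>i\<close> of alternating products that do not begin in \<open>M\<^sub>i\<close>
  (\<open>decomposition\<close>, \<open>decomposition_unique\<close>). All left-handed axioms follow. Left cancellation
  reduces to that of \<open>M\<^sub>i\<close>. If \<open>a = x t\<close> with \<open>x \<in> M\<^sub>i\<close> and \<open>t \<in> T\<^sub>i\<close>, then \<open>x\<close> is the greatest left divisor of \<open>a\<close>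
  in \<open>M\<^sub>i\<close> (\<open>A_left_divisor\<close>); hence the join of two elements of \<open>M\<^sub>i\<close> may be formed in \<open>M\<^sub>i\<close>, and
  elements of different factors have a common multiple only if one of them lies in \<open>N\<close>. So the
  generating set \<open>M\<^sub>1 \<union> M\<^sub>2\<close> has conditional joins and is closed under the complements \<open>x'\<close>, \<open>y'\<close>
  in \<open>x y' = y x'\<close>; tiling a grid with these squares produces joins of arbitrary elements
  (\<open>generator_any_left_join\<close>, \<open>ex_left_join\<close>). For atomicity, the number of nontrivial generators in
  a factorization of \<open>x t\<close> is bounded by the norm of \<open>x\<close> plus the bound for \<open>d t\<close>, where \<open>d\<close> is the
  greatest right divisor of \<open>x\<close> in \<open>N\<close> (\<open>bounded_step\<close>); the greatest length of a factorization is then a norm.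

  The right-handed axioms are the left-handed ones for the opposite monoid, and reversal of words
  identifies it with the amalgam of the opposite factors (\<open>opposite_amalgamated_product_iso\<close>).
\<close>

section \<open>Opposite monoids and one-sided axioms\<close>

definition opposite :: "('a, 'x) monoid_scheme \<Rightarrow> 'a monoid"
  where "opposite G = \<lparr>carrier = carrier G, monoid.mult = (\<lambda>x y. y \<otimes>\<^bsub>G\<^esub> x), one = \<one>\<^bsub>G\<^esub>\<rparr>"

lemma opposite_simps [simp]:
  "carrier (opposite G) = carrier G"
  "x \<otimes>\<^bsub>opposite G\<^esub> y = y \<otimes>\<^bsub>G\<^esub> x"
  "\<one>\<^bsub>opposite G\<^esub> = \<one>\<^bsub>G\<^esub>"
  by (simp_all add: opposite_def)

lemma (in monoid) monoid_opposite: "monoid (opposite G)"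
  by (rule monoidI) (simp_all add: m_assoc)

lemma divides_opposite [simp]: "a divides\<^bsub>opposite G\<^esub> b \<longleftrightarrow> a rdivides\<^bsub>G\<^esub> b"
  by (simp add: factor_def right_divides_def)

lemma rdivides_opposite [simp]: "a rdivides\<^bsub>opposite G\<^esub> b \<longleftrightarrow> a divides\<^bsub>G\<^esub> b"
  by (simp add: factor_def right_divides_def)

lemma is_left_join_opposite [simp]: "is_left_join (opposite G) a b s \<longleftrightarrow> is_right_join G a b s"
  by (simp add: is_left_join_def is_right_join_def islcm_def)

lemma is_right_join_opposite [simp]: "is_right_join (opposite G) a b s \<longleftrightarrow> is_left_join G a b s"
  by (simp add: is_left_join_def is_right_join_def islcm_def)

text \<open>
  The norm condition is self-dual. It stands with the left-handed axioms because normal forms with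
  the coefficient on the left yield cancellation, joins and a norm together.
\<close>

locale left_preGarside_monoid = monoid +
  assumes left_cancel:
    "\<lbrakk>c \<otimes> a = c \<otimes> b; a \<in> carrier G; b \<in> carrier G; c \<in> carrier G\<rbrakk> \<Longrightarrow> a = b"
    and ex_norm:
    "\<exists>\<nu> :: 'a \<Rightarrow> nat. (\<forall>a\<in>carrier G. a \<noteq> \<one> \<longrightarrow> \<nu> a > 0) \<and>
      (\<forall>a\<in>carrier G. \<forall>b\<in>carrier G. \<nu> (a \<otimes> b) \<ge> \<nu> a + \<nu> b)"
    and ex_left_join:
    "\<lbrakk>a \<in> carrier G; b \<in> carrier G; \<exists>m\<in>carrier G. a divides m \<and> b divides m\<rbrakk>
      \<Longrightarrow> \<exists>s. is_left_join G a b s"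

lemma preGarside_monoid_iff:
  "preGarside_monoid G \<longleftrightarrow> left_preGarside_monoid G \<and> left_preGarside_monoid (opposite G)"
proof safe
  assume "preGarside_monoid G"
  then interpret preGarside_monoid G .
  show "left_preGarside_monoid G"
  proof
    show "a = b" if "c \<otimes>\<^bsub>G\<^esub> a = c \<otimes>\<^bsub>G\<^esub> b" "a \<in> carrier G" "b \<in> carrier G" "c \<in> carrier G" for a b c
      using cancel[of c a "\<one>\<^bsub>G\<^esub>" b] that by simp
  qed (fact ex_norm, fact ex_left_join)
  interpret op: monoid "opposite G" by (rule monoid_opposite)
  show "left_preGarside_monoid (opposite G)"
  proof
    show "a = b" if "c \<otimes>\<^bsub>opposite G\<^esub> a = c \<otimes>\<^bsub>opposite G\<^esub> b" "a \<in> carrier (opposite G)"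
      "b \<in> carrier (opposite G)" "c \<in> carrier (opposite G)" for a b c
      using cancel[of "\<one>\<^bsub>G\<^esub>" a c b] that by simp
    show "\<exists>\<nu> :: _ \<Rightarrow> nat.
      (\<forall>a\<in>carrier (opposite G). a \<noteq> \<one>\<^bsub>opposite G\<^esub> \<longrightarrow> \<nu> a > 0) \<and>
      (\<forall>a\<in>carrier (opposite G). \<forall>b\<in>carrier (opposite G). \<nu> (a \<otimes>\<^bsub>opposite G\<^esub> b) \<ge> \<nu> a + \<nu> b)"
    proof -
      obtain \<nu> :: "_ \<Rightarrow> nat" where "\<forall>a\<in>carrier G. a \<noteq> \<one>\<^bsub>G\<^esub> \<longrightarrow> \<nu> a > 0"
        and \<nu>: "\<forall>a\<in>carrier G. \<forall>b\<in>carrier G. \<nu> (a \<otimes>\<^bsub>G\<^esub> b) \<ge> \<nu> a + \<nu> b"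
        using ex_norm by blast
      moreover have "\<nu> a + \<nu> b \<le> \<nu> (b \<otimes>\<^bsub>G\<^esub> a)" if "a \<in> carrier G" "b \<in> carrier G" for a b
        using \<nu> that by (subst add.commute) blast
      ultimately show ?thesis by (intro exI[of _ \<nu>]) simp
    qed
    show "\<exists>s. is_left_join (opposite G) a b s"
      if "a \<in> carrier (opposite G)" "b \<in> carrier (opposite G)"
        "\<exists>m\<in>carrier (opposite G). a divides\<^bsub>opposite G\<^esub> m \<and> b divides\<^bsub>opposite G\<^esub> m" for a b
      using ex_right_join[of a b] that by simp
  qed
next
  assume "left_preGarside_monoid G"
  then interpret l: left_preGarside_monoid G .
  assume "left_preGarside_monoid (opposite G)"
  then interpret r: left_preGarside_monoid "opposite G" .
  show "preGarside_monoid G"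
  proof
    fix a b c d
    assume *: "c \<otimes>\<^bsub>G\<^esub> a \<otimes>\<^bsub>G\<^esub> d = c \<otimes>\<^bsub>G\<^esub> b \<otimes>\<^bsub>G\<^esub> d" "a \<in> carrier G" "b \<in> carrier G"
      "c \<in> carrier G" "d \<in> carrier G"
    then have "a \<otimes>\<^bsub>G\<^esub> d = b \<otimes>\<^bsub>G\<^esub> d"
      using l.left_cancel[of c "a \<otimes>\<^bsub>G\<^esub> d" "b \<otimes>\<^bsub>G\<^esub> d"] by (simp add: l.m_assoc)
    then show "a = b" using r.left_cancel[of d a b] * by simp
  next
    show "\<exists>s. is_right_join G a b s"
      if "a \<in> carrier G" "b \<in> carrier G" "\<exists>m\<in>carrier G. a rdivides\<^bsub>G\<^esub> m \<and> b rdivides\<^bsub>G\<^esub> m" for a b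
      using r.ex_left_join[of a b] that by simp
  qed (fact l.ex_norm, fact l.ex_left_join)
qed

text \<open>
  The factors of the amalgam will be handled as submonoids of the amalgam itself, and its opposite
  as another amalgam; both steps replace a monoid by an isomorphic copy.
\<close>

lemma left_preGarside_monoid_iso:
  assumes "left_preGarside_monoid M" "monoid K" and h: "h \<in> iso M K"
  shows "left_preGarside_monoid K"
proof -
  interpret M: left_preGarside_monoid M by fact
  interpret K: monoid K by fact
  define g where "g = inv_into (carrier M) h"
  have hg: "h (g y) = y" if "y \<in> carrier K" for y
    using that h unfolding g_def iso_def by (auto simp: bij_betw_def intro: f_inv_into_f)
  have gh: "g (h x) = x" if "x \<in> carrier M" for x
    using that h unfolding g_def iso_def by (auto simp: bij_betw_def)
  have hc: "h x \<in> carrier K" if "x \<in> carrier M" for x using that h by (auto simp: iso_def hom_def)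
  have gc: "g y \<in> carrier M" if "y \<in> carrier K" for y
    using that h unfolding g_def iso_def by (auto simp: bij_betw_def intro: inv_into_into)
  have hm: "h (x \<otimes>\<^bsub>M\<^esub> y) = h x \<otimes>\<^bsub>K\<^esub> h y" if "x \<in> carrier M" "y \<in> carrier M" for x y
    using that h by (auto simp: iso_def hom_def)
  have gm: "g (x \<otimes>\<^bsub>K\<^esub> y) = g x \<otimes>\<^bsub>M\<^esub> g y" if "x \<in> carrier K" "y \<in> carrier K" for x y
  proof -
    have "x \<otimes>\<^bsub>K\<^esub> y = h (g x \<otimes>\<^bsub>M\<^esub> g y)" using that by (simp add: hm hg gc)
    then show ?thesis using gh gc that by simp
  qed
  have g1: "g y \<noteq> \<one>\<^bsub>M\<^esub>" if "y \<in> carrier K" "y \<noteq> \<one>\<^bsub>K\<^esub>" for y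
  proof
    assume "g y = \<one>\<^bsub>M\<^esub>"
    then have "y \<otimes>\<^bsub>K\<^esub> \<one>\<^bsub>K\<^esub> = \<one>\<^bsub>K\<^esub>"
      using hg[of "y \<otimes>\<^bsub>K\<^esub> \<one>\<^bsub>K\<^esub>"] gm[of y "\<one>\<^bsub>K\<^esub>"] hg[of "\<one>\<^bsub>K\<^esub>"] that gc by simp
    then show False using that by simp
  qed
  have div: "x divides\<^bsub>K\<^esub> y \<longleftrightarrow> g x divides\<^bsub>M\<^esub> g y" if "x \<in> carrier K" "y \<in> carrier K" for x y
  proof
    assume "g x divides\<^bsub>M\<^esub> g y"
    then obtain c where "c \<in> carrier M" "g y = g x \<otimes>\<^bsub>M\<^esub> c" by (auto simp: factor_def)
    then have "y = x \<otimes>\<^bsub>K\<^esub> h c" using hg hm gc that by metis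
    then show "x divides\<^bsub>K\<^esub> y" using \<open>c \<in> carrier M\<close> hc by (auto simp: factor_def)
  qed (use that gm gc in \<open>auto simp: factor_def\<close>)
  show ?thesis
  proof
    fix a b c
    assume *: "c \<otimes>\<^bsub>K\<^esub> a = c \<otimes>\<^bsub>K\<^esub> b" "a \<in> carrier K" "b \<in> carrier K" "c \<in> carrier K"
    then have "g c \<otimes>\<^bsub>M\<^esub> g a = g c \<otimes>\<^bsub>M\<^esub> g b" by (metis gm)
    then show "a = b" using * M.left_cancel gc hg by metis
  next
    obtain \<nu> :: "_ \<Rightarrow> nat" where "\<forall>a\<in>carrier M. a \<noteq> \<one>\<^bsub>M\<^esub> \<longrightarrow> \<nu> a > 0"
      "\<forall>a\<in>carrier M. \<forall>b\<in>carrier M. \<nu> (a \<otimes>\<^bsub>M\<^esub> b) \<ge> \<nu> a + \<nu> b"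
      using M.ex_norm by blast
    then show "\<exists>\<nu> :: _ \<Rightarrow> nat. (\<forall>a\<in>carrier K. a \<noteq> \<one>\<^bsub>K\<^esub> \<longrightarrow> \<nu> a > 0) \<and>
      (\<forall>a\<in>carrier K. \<forall>b\<in>carrier K. \<nu> (a \<otimes>\<^bsub>K\<^esub> b) \<ge> \<nu> a + \<nu> b)"
      using g1 gm gc by (intro exI[of _ "\<nu> \<circ> g"]) auto
  next
    fix a b
    assume *: "a \<in> carrier K" "b \<in> carrier K" "\<exists>m\<in>carrier K. a divides\<^bsub>K\<^esub> m \<and> b divides\<^bsub>K\<^esub> m"
    then obtain m where "m \<in> carrier K" "a divides\<^bsub>K\<^esub> m" "b divides\<^bsub>K\<^esub> m" by blast
    then have "g m \<in> carrier M" "g a divides\<^bsub>M\<^esub> g m" "g b divides\<^bsub>M\<^esub> g m"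
      using * by (simp_all add: gc flip: div)
    then obtain s where "is_left_join M (g a) (g b) s"
      using M.ex_left_join[of "g a" "g b"] * gc by blast
    then have s: "s \<in> carrier M" "g a divides\<^bsub>M\<^esub> s" "g b divides\<^bsub>M\<^esub> s"
      and least: "\<And>y. \<lbrakk>y \<in> carrier M; g a divides\<^bsub>M\<^esub> y; g b divides\<^bsub>M\<^esub> y\<rbrakk> \<Longrightarrow> s divides\<^bsub>M\<^esub> y"
      by (simp_all add: is_left_join_def islcm_def)
    then have "is_left_join K a b (h s)"
      unfolding is_left_join_def islcm_def by (simp add: div hc gh gc * s least)
    then show "\<exists>s. is_left_join K a b s" ..
  qed
qed

lemma preGarside_monoid_iso:
  assumes "preGarside_monoid M" "monoid K" and "h \<in> iso M K"
  shows "preGarside_monoid K"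
proof -
  have "left_preGarside_monoid M" "left_preGarside_monoid (opposite M)"
    using assms(1) by (simp_all add: preGarside_monoid_iff)
  moreover have "h \<in> iso (opposite M) (opposite K)" using assms(3) by (auto simp: iso_def hom_def)
  moreover have "monoid (opposite K)" using assms(2) by (rule monoid.monoid_opposite)
  ultimately have "left_preGarside_monoid K" "left_preGarside_monoid (opposite K)"
    using assms(2,3) left_preGarside_monoid_iso by - (blast, blast)
  then show ?thesis by (simp add: preGarside_monoid_iff)
qed

lemma parabolic_submonoid_iso:
  assumes "parabolic_submonoid H M" "monoid M" "monoid K" and h: "h \<in> iso M K" "h \<one>\<^bsub>M\<^esub> = \<one>\<^bsub>K\<^esub>"
  shows "parabolic_submonoid (h ` H) K"
proof -
  interpret parabolic_submonoid H M by fact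
  interpret M: monoid M by fact
  interpret K: monoid K by fact
  have hc: "h x \<in> carrier K" if "x \<in> carrier M" for x using that h by (auto simp: iso_def hom_def)
  have hm: "h (x \<otimes>\<^bsub>M\<^esub> y) = h x \<otimes>\<^bsub>K\<^esub> h y" if "x \<in> carrier M" "y \<in> carrier M" for x y
    using that h by (auto simp: iso_def hom_def)
  have surj: "\<exists>x\<in>carrier M. y = h x" if "y \<in> carrier K" for y
    using that h by (auto simp: iso_def bij_betw_def)
  have inj: "x = y" if "h x = h y" "x \<in> carrier M" "y \<in> carrier M" for x y
    using that h by (auto simp: iso_def bij_betw_def inj_on_def)
  have div: "h x divides\<^bsub>K\<^esub> h y \<longleftrightarrow> x divides\<^bsub>M\<^esub> y" and rdiv: "h x rdivides\<^bsub>K\<^esub> h y \<longleftrightarrow> x rdivides\<^bsub>M\<^esub> y"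
    if "x \<in> carrier M" "y \<in> carrier M" for x y
    unfolding factor_def right_divides_def using surj inj hc hm that M.m_closed by metis+
  have ball: "(\<forall>y\<in>carrier K. Q y) \<longleftrightarrow> (\<forall>x\<in>carrier M. Q (h x))" for Q
    using surj hc by metis
  have mem: "x \<in> carrier M" if "x \<in> H" for x using subset that by blast
  have lj: "is_left_join K (h a) (h b) (h s) \<longleftrightarrow> is_left_join M a b s"
    and rj: "is_right_join K (h a) (h b) (h s) \<longleftrightarrow> is_right_join M a b s"
    if "a \<in> carrier M" "b \<in> carrier M" "s \<in> carrier M" for a b s
    using that hc by (simp_all add: is_left_join_def is_right_join_def islcm_def ball div rdiv)
  show ?thesis
  proof
    show "h ` H \<subseteq> carrier K" using hc mem by blast
    show "x \<otimes>\<^bsub>K\<^esub> y \<in> h ` H" if "x \<in> h ` H" "y \<in> h ` H" for x y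
      using that by (auto simp: mem simp flip: hm)
    show "\<one>\<^bsub>K\<^esub> \<in> h ` H" using imageI[OF one_closed, of h] h(2) by simp
    show "a \<in> h ` H \<and> b \<in> h ` H" if ab: "a \<in> carrier K" "b \<in> carrier K" "a \<otimes>\<^bsub>K\<^esub> b \<in> h ` H" for a b
    proof -
      obtain x y where xy: "x \<in> carrier M" "a = h x" "y \<in> carrier M" "b = h y"
        using surj[OF ab(1)] surj[OF ab(2)] by blast
      then obtain z where z: "z \<in> H" "h (x \<otimes>\<^bsub>M\<^esub> y) = h z" using ab(3) by (auto simp: hm)
      then have "x \<otimes>\<^bsub>M\<^esub> y \<in> H" using inj[of "x \<otimes>\<^bsub>M\<^esub> y" z] mem xy by simp
      then show ?thesis using factors_closed xy by blast
    qed
    show "s \<in> h ` H" if *: "a \<in> h ` H" "b \<in> h ` H" "is_left_join K a b s" for a b s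
    proof -
      obtain x y z where xyz: "x \<in> H" "a = h x" "y \<in> H" "b = h y" "z \<in> carrier M" "s = h z"
        using * surj[of s] by (auto simp: is_left_join_def)
      then have "is_left_join M x y z" using that lj[of x y z] mem by simp
      then show ?thesis using xyz left_join_closed by blast
    qed
    show "s \<in> h ` H" if *: "a \<in> h ` H" "b \<in> h ` H" "is_right_join K a b s" for a b s
    proof -
      obtain x y z where xyz: "x \<in> H" "a = h x" "y \<in> H" "b = h y" "z \<in> carrier M" "s = h z"
        using * surj[of s] by (auto simp: is_right_join_def)
      then have "is_right_join M x y z" using that rj[of x y z] mem by simp
      then show ?thesis using xyz right_join_closed by blast
    qed
  qed
qed

section \<open>Greatest divisors in a parabolic submonoid\<close>

text \<open>
  The predicate is invariant under passing to the opposite monoid, so statements about left divisors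
  can be reflected; greatest right divisors are obtained below in this way.
\<close>

locale parabolic_in_preGarside = preGarside_monoid G + parabolic_submonoid H G
  for H and G (structure)
begin

lemma opposite: "parabolic_in_preGarside H (opposite G)"
proof -
  have "preGarside_monoid (opposite G)"
  proof -
    have "left_preGarside_monoid (opposite (opposite G))"
      by (rule left_preGarside_monoid_iso[of G _ "\<lambda>x. x"])
        (use preGarside_monoid_iff[of G] preGarside_monoid_axioms monoid.monoid_opposite monoid_opposite
          in \<open>auto simp: iso_def hom_def bij_betw_def\<close>)
    then show ?thesis
      using preGarside_monoid_iff[of G] preGarside_monoid_iff[of "opposite G"] preGarside_monoid_axioms
      by simp
  qed
  moreover have "parabolic_submonoid H (opposite G)"
  proof
    show "a \<in> H \<and> b \<in> H"
      if "a \<in> carrier (opposite G)" "b \<in> carrier (opposite G)" "a \<otimes>\<^bsub>opposite G\<^esub> b \<in> H" for a b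
      using factors_closed[of b a] that by simp
    show "s \<in> H" if "a \<in> H" "b \<in> H" "is_left_join (opposite G) a b s" for a b s
      using right_join_closed[of a b s] that by simp
    show "s \<in> H" if "a \<in> H" "b \<in> H" "is_right_join (opposite G) a b s" for a b s
      using left_join_closed[of a b s] that by simp
  qed (use subset in simp_all)
  ultimately show ?thesis by (rule parabolic_in_preGarside.intro)
qed

lemma in_carrier: "n \<in> H \<Longrightarrow> n \<in> carrier G"
  using subset by blast

lemma left_cancel:
  "\<lbrakk>c \<otimes> a = c \<otimes> b; a \<in> carrier G; b \<in> carrier G; c \<in> carrier G\<rbrakk> \<Longrightarrow> a = b"
  using cancel[of c a \<one> b] by simp

lemma conical: "\<lbrakk>a \<otimes> b = \<one>; a \<in> carrier G; b \<in> carrier G\<rbrakk> \<Longrightarrow> a = \<one>"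
proof (rule ccontr)
  assume *: "a \<otimes> b = \<one>" "a \<in> carrier G" "b \<in> carrier G" "a \<noteq> \<one>"
  obtain \<nu> :: "_ \<Rightarrow> nat" where pos: "\<And>a. a \<in> carrier G \<Longrightarrow> a \<noteq> \<one> \<Longrightarrow> \<nu> a > 0"
      and \<nu>: "\<And>a b. a \<in> carrier G \<Longrightarrow> b \<in> carrier G \<Longrightarrow> \<nu> (a \<otimes> b) \<ge> \<nu> a + \<nu> b"
      using ex_norm by blast
  have "\<nu> a > 0" using pos * by blast
  moreover have "\<nu> a + \<nu> b \<le> \<nu> \<one>" using \<nu>[of a b] * by simp
  moreover have "\<nu> \<one> + \<nu> \<one> \<le> \<nu> \<one>" using \<nu>[of \<one> \<one>] by simp
  ultimately show False by simp
qed

text \<open>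
  The divisor \<open>n \<in> H\<close> of \<open>x\<close> of maximal norm is greatest: its join with another divisor \<open>m \<in> H\<close> of \<open>x\<close>
  lies in \<open>H\<close> and divides \<open>x\<close> too, so it cannot have larger norm and must equal \<open>n\<close>.
\<close>

lemma greatest_left_divisor:
  assumes x: "x \<in> carrier G"
  obtains n r where "n \<in> H" "r \<in> carrier G" "x = n \<otimes> r"
    "\<And>m. \<lbrakk>m \<in> H; m divides x\<rbrakk> \<Longrightarrow> \<exists>c\<in>H. n = m \<otimes> c"
proof -
  obtain \<nu> :: "_ \<Rightarrow> nat" where pos: "\<And>a. a \<in> carrier G \<Longrightarrow> a \<noteq> \<one> \<Longrightarrow> \<nu> a > 0"
      and \<nu>: "\<And>a b. a \<in> carrier G \<Longrightarrow> b \<in> carrier G \<Longrightarrow> \<nu> (a \<otimes> b) \<ge> \<nu> a + \<nu> b"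
      using ex_norm by blast
  define D where "D n \<longleftrightarrow> n \<in> H \<and> n divides x" for n
  have "D \<one>" using x by (auto simp: D_def factor_def)
  moreover have "\<nu> n \<le> \<nu> x" if "D n" for n
  proof -
    obtain c where "n \<in> carrier G" "c \<in> carrier G" "x = n \<otimes> c"
      using \<open>D n\<close> in_carrier by (auto simp: D_def factor_def)
    then show ?thesis using \<nu>[of n c] by simp
  qed
  ultimately obtain n where n: "D n" "\<And>m. D m \<Longrightarrow> \<nu> m \<le> \<nu> n"
    using ex_has_greatest_nat[of D \<one> \<nu> "Suc (\<nu> x)"] by (auto simp: less_Suc_eq_le)
  obtain r where r: "r \<in> carrier G" "x = n \<otimes> r" using n by (auto simp: D_def factor_def)
  have "\<exists>c\<in>H. n = m \<otimes> c" if m: "m \<in> H" "m divides x" for m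
  proof -
    obtain s where s: "is_left_join G n m s"
      using ex_left_join[of n m] n m x in_carrier by (auto simp: D_def)
    then have "s \<in> H" using left_join_closed[of n m s] n m by (simp add: D_def)
    moreover have "s divides x" using s n m x by (simp add: D_def is_left_join_def islcm_def)
    ultimately have le: "\<nu> s \<le> \<nu> n" using n by (simp add: D_def)
    obtain c where c: "c \<in> carrier G" "s = n \<otimes> c" using s by (auto simp: is_left_join_def islcm_def factor_def)
    then have "c = \<one>" using le pos[of c] \<nu>[of n c] in_carrier n by (fastforce simp: D_def)
    then have "s = n" using c n in_carrier by (simp add: D_def)
    then obtain d where d: "d \<in> carrier G" "n = m \<otimes> d"
      using s by (auto simp: is_left_join_def islcm_def factor_def)
    then have "m \<otimes> d \<in> H" using n by (simp add: D_def)
    then have "d \<in> H" using factors_closed d m in_carrier by blast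
    then show ?thesis using d by blast
  qed
  then show thesis using that[of n r] n r by (simp add: D_def)
qed

lemma greatest_right_divisor:
  assumes x: "x \<in> carrier G"
  obtains n r where "n \<in> H" "r \<in> carrier G" "x = r \<otimes> n"
    "\<And>m. \<lbrakk>m \<in> H; m rdivides x\<rbrakk> \<Longrightarrow> \<exists>c\<in>H. n = c \<otimes> m"
  using parabolic_in_preGarside.greatest_left_divisor[OF opposite, of x] x by auto

definition reduced :: "'a set"
  where "reduced = {r \<in> carrier G. \<forall>n\<in>H. n divides r \<longrightarrow> n = \<one>}"

lemma one_reduced: "\<one> \<in> reduced"
  using conical in_carrier by (force simp: reduced_def factor_def)

text \<open>
  The cofactor of the greatest left divisor in \<open>H\<close> is reduced; conversely a reduced cofactor can
  only belong to the greatest divisor. So \<open>G\<close> is a free left \<open>H\<close>-set with basis \<open>reduced\<close>.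
\<close>

lemma reduced_decomposition:
  assumes x: "x \<in> carrier G"
  obtains n r where "n \<in> H" "r \<in> reduced" "x = n \<otimes> r"
proof -
  obtain n r where nr: "n \<in> H" "r \<in> carrier G" "x = n \<otimes> r"
    and max: "\<And>m. \<lbrakk>m \<in> H; m divides x\<rbrakk> \<Longrightarrow> \<exists>c\<in>H. n = m \<otimes> c"
    using greatest_left_divisor[OF x] by blast
  have "m = \<one>" if m: "m \<in> H" "m divides r" for m
  proof -
    obtain z where z: "z \<in> carrier G" "r = m \<otimes> z" using m by (auto simp: factor_def)
    then have "n \<otimes> m divides x" using nr m in_carrier by (auto simp: factor_def m_assoc)
    then obtain c where c: "c \<in> H" "n = n \<otimes> m \<otimes> c" using max nr m by blast
    then have "m \<otimes> c = \<one>" using left_cancel[of n "m \<otimes> c" \<one>] nr m in_carrier by (simp add: m_assoc)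
    then show ?thesis using conical m c in_carrier by blast
  qed
  then have "r \<in> reduced" using nr by (simp add: reduced_def)
  then show thesis using that[of n r] nr by blast
qed

lemma reduced_decomposition_unique:
  assumes eq: "n \<otimes> r = m \<otimes> s" and n: "n \<in> H" and m: "m \<in> H" and r: "r \<in> reduced" and s: "s \<in> reduced"
  shows "n = m \<and> r = s"
proof -
  have rs: "r \<in> carrier G" "s \<in> carrier G" using r s by (simp_all add: reduced_def)
  obtain d z where d: "d \<in> H" "z \<in> carrier G" "n \<otimes> r = d \<otimes> z"
    and max: "\<And>m. \<lbrakk>m \<in> H; m divides (n \<otimes> r)\<rbrakk> \<Longrightarrow> \<exists>c\<in>H. d = m \<otimes> c"
    using greatest_left_divisor[of "n \<otimes> r"] n rs in_carrier by blast
  \<comment> \<open>A reduced cofactor forces its partner to be the greatest divisor.\<close>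
  have "n' = d" if n': "n' \<in> H" "r' \<in> reduced" "n' \<otimes> r' = n \<otimes> r" for n' r'
  proof -
    have r': "r' \<in> carrier G" using n' by (simp add: reduced_def)
    then have "n' divides (n \<otimes> r)" unfolding factor_def using n' by metis
    then obtain c where c: "c \<in> H" "d = n' \<otimes> c" using max n' by blast
    then have "r' = c \<otimes> z"
      using left_cancel[of n' r' "c \<otimes> z"] n' d r' in_carrier by (simp add: m_assoc)
    then have "c = \<one>" using n'(2) c d by (auto simp: reduced_def factor_def)
    then show ?thesis using c n' in_carrier by simp
  qed
  from this[of n r] this[of m s] have "n = m" using assms by auto
  then show ?thesis using left_cancel[of n r s] eq rs n in_carrier by auto
qed

end

section \<open>Monoids with amalgam normal forms\<close>

text \<open>
  Each letter carries the factor it comes from as a tag: untagged, an element of the amalgam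
  could conceivably be a letter on both sides, and uniqueness of the normal form has to exclude this.
\<close>

fun alternating :: "(bool \<Rightarrow> 'a set) \<Rightarrow> bool \<Rightarrow> (bool \<times> 'a) list \<Rightarrow> bool"
  where
    "alternating S i [] \<longleftrightarrow> True"
  | "alternating S i ((j, r) # w) \<longleftrightarrow> j = i \<and> r \<in> S i \<and> alternating S (\<not> i) w"

definition word_product :: "('a, 'x) monoid_scheme \<Rightarrow> (bool \<times> 'a) list \<Rightarrow> 'a"
  where "word_product G w = foldr (\<lambda>(_, r) p. r \<otimes>\<^bsub>G\<^esub> p) w \<one>\<^bsub>G\<^esub>"

lemma word_product_simps [simp]:
  "word_product G [] = \<one>\<^bsub>G\<^esub>"
  "word_product G ((j, r) # w) = r \<otimes>\<^bsub>G\<^esub> word_product G w"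
  by (simp_all add: word_product_def)

text \<open>
  What is used of an amalgam \<open>G\<close>, with both factors \<open>A True\<close> and \<open>A False\<close> inside \<open>G\<close> so that one
  argument serves for both: \<open>generated\<close> is induction over products of elements of the factors, and
  \<open>normal_form_unique\<close> is uniqueness of \<open>n r\<^sub>1 \<dots> r\<^sub>k\<close>. Existence of normal forms is a consequence.
\<close>

locale amalgam_of_submonoids = monoid G for G (structure) +
  fixes A :: "bool \<Rightarrow> 'a set" and N :: "'a set"
  assumes A_subset: "A i \<subseteq> carrier G"
    and factor: "parabolic_in_preGarside N (G\<lparr>carrier := A i\<rparr>)"
    and generated: "\<lbrakk>\<one> \<in> Q; \<And>i x b. \<lbrakk>x \<in> A i; b \<in> Q\<rbrakk> \<Longrightarrow> x \<otimes> b \<in> Q\<rbrakk> \<Longrightarrow> carrier G \<subseteq> Q"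
    and normal_form_unique:
      "\<lbrakk>n \<in> N; m \<in> N;
        alternating (\<lambda>i. parabolic_in_preGarside.reduced N (G\<lparr>carrier := A i\<rparr>) - {\<one>}) i w;
        alternating (\<lambda>i. parabolic_in_preGarside.reduced N (G\<lparr>carrier := A i\<rparr>) - {\<one>}) j v;
        n \<otimes> word_product G w = m \<otimes> word_product G v\<rbrakk> \<Longrightarrow> n = m \<and> w = v"
begin

definition "R i = parabolic_in_preGarside.reduced N (G\<lparr>carrier := A i\<rparr>) - {\<one>}"

abbreviation "alt \<equiv> alternating R"

abbreviation "wprod \<equiv> word_product G"

lemma A_closed: "x \<in> A i \<Longrightarrow> x \<in> carrier G"
  using A_subset by blast

lemma A_mult: "x \<in> A i \<Longrightarrow> y \<in> A i \<Longrightarrow> x \<otimes> y \<in> A i"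
  and A_one: "\<one> \<in> A i"
  and N_A: "n \<in> N \<Longrightarrow> n \<in> A i"
  and N_one: "\<one> \<in> N"
  and N_factors: "\<lbrakk>x \<otimes> y \<in> N; x \<in> A i; y \<in> A i\<rbrakk> \<Longrightarrow> x \<in> N \<and> y \<in> N"
proof -
  interpret F: parabolic_in_preGarside N "G\<lparr>carrier := A i\<rparr>" by (rule factor)
  show "x \<in> A i \<Longrightarrow> y \<in> A i \<Longrightarrow> x \<otimes> y \<in> A i" using monoid.m_closed[OF F.monoid_axioms, of x y] by simp
  show "\<one> \<in> A i" using monoid.one_closed[OF F.monoid_axioms] by simp
  show "n \<in> N \<Longrightarrow> n \<in> A i" using F.in_carrier by simp
  show "\<one> \<in> N" using F.one_closed by simp
  show "\<lbrakk>x \<otimes> y \<in> N; x \<in> A i; y \<in> A i\<rbrakk> \<Longrightarrow> x \<in> N \<and> y \<in> N" using F.factors_closed[of x y] by simp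
qed

lemma N_closed: "n \<in> N \<Longrightarrow> n \<in> carrier G"
  using N_A A_closed by blast

lemma R_A: "r \<in> R i \<Longrightarrow> r \<in> A i"
  by (simp add: R_def parabolic_in_preGarside.reduced_def[OF factor])

lemma R_closed: "r \<in> R i \<Longrightarrow> r \<in> carrier G"
  using R_A A_closed by blast

lemma A_decomposition:
  assumes "x \<in> A i"
  obtains "x \<in> N" | n r where "n \<in> N" "r \<in> R i" "x = n \<otimes> r"
proof -
  interpret F: parabolic_in_preGarside N "G\<lparr>carrier := A i\<rparr>" by (rule factor)
  obtain n r where nr: "n \<in> N" "r \<in> F.reduced" "x = n \<otimes> r"
    using F.reduced_decomposition[of x] assms by auto
  show thesis
  proof (cases "r = \<one>")
    case True
    then show thesis using that(1) nr N_closed by simp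
  next
    case False
    then show thesis using that(2)[of n r] nr by (simp add: R_def)
  qed
qed

lemma A_norm:
  obtains \<nu> :: "'a \<Rightarrow> nat" where "\<And>x. \<lbrakk>x \<in> A i; x \<noteq> \<one>\<rbrakk> \<Longrightarrow> 0 < \<nu> x"
    "\<And>x y. \<lbrakk>x \<in> A i; y \<in> A i\<rbrakk> \<Longrightarrow> \<nu> x + \<nu> y \<le> \<nu> (x \<otimes> y)"
proof -
  interpret F: parabolic_in_preGarside N "G\<lparr>carrier := A i\<rparr>" by (rule factor)
  show thesis using that F.ex_norm by auto
qed

lemma A_join:
  assumes "x \<in> A i" "y \<in> A i" "u \<in> A i" "v \<in> A i" "x \<otimes> u = y \<otimes> v"
  obtains x' y' where "x' \<in> A i" "y' \<in> A i" "x \<otimes> y' = y \<otimes> x'"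
    "\<And>u v. \<lbrakk>u \<in> A i; v \<in> A i; x \<otimes> u = y \<otimes> v\<rbrakk> \<Longrightarrow> \<exists>z\<in>A i. x \<otimes> u = x \<otimes> y' \<otimes> z"
proof -
  interpret F: parabolic_in_preGarside N "G\<lparr>carrier := A i\<rparr>" by (rule factor)
  have div: "a divides\<^bsub>G\<lparr>carrier := A i\<rparr>\<^esub> b \<longleftrightarrow> (\<exists>c\<in>A i. b = a \<otimes> c)" for a b
    by (simp add: factor_def)
  have "x divides\<^bsub>G\<lparr>carrier := A i\<rparr>\<^esub> (x \<otimes> u)" "y divides\<^bsub>G\<lparr>carrier := A i\<rparr>\<^esub> (x \<otimes> u)"
    unfolding div using assms by blast+
  moreover have "x \<otimes> u \<in> A i" using assms A_mult by blast
  ultimately have "\<exists>s. is_left_join (G\<lparr>carrier := A i\<rparr>) x y s"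
    using assms by (intro F.ex_left_join) auto
  then obtain s where s: "is_left_join (G\<lparr>carrier := A i\<rparr>) x y s" ..
  then obtain x' y' where xy: "x' \<in> A i" "s = y \<otimes> x'" "y' \<in> A i" "s = x \<otimes> y'"
    by (auto simp: is_left_join_def islcm_def div)
  have "\<exists>z\<in>A i. x \<otimes> u = x \<otimes> y' \<otimes> z" if "u \<in> A i" "v \<in> A i" "x \<otimes> u = y \<otimes> v" for u v
  proof -
    have "x \<otimes> u \<in> A i" using that assms A_mult by blast
    moreover have "x divides\<^bsub>G\<lparr>carrier := A i\<rparr>\<^esub> (x \<otimes> u)" "y divides\<^bsub>G\<lparr>carrier := A i\<rparr>\<^esub> (x \<otimes> u)"
      unfolding div using that by blast+
    ultimately have "s divides\<^bsub>G\<lparr>carrier := A i\<rparr>\<^esub> (x \<otimes> u)"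
      using s by (simp add: is_left_join_def islcm_def)
    then show ?thesis using div xy by simp
  qed
  then show thesis using that[of x' y'] xy by simp
qed

lemma A_greatest_right_N_divisor:
  assumes "x \<in> A i"
  obtains d where "d \<in> N" "\<And>y b. \<lbrakk>y \<in> A i; b \<in> N; x = y \<otimes> b\<rbrakk> \<Longrightarrow> \<exists>c\<in>N. d = c \<otimes> b"
proof -
  interpret F: parabolic_in_preGarside N "G\<lparr>carrier := A i\<rparr>" by (rule factor)
  show thesis
    using F.greatest_right_divisor[of x] assms that
    by (simp add: right_divides_def) metis
qed

lemma alt_closed: "alt i w \<Longrightarrow> wprod w \<in> carrier G"
proof (induction w arbitrary: i)
  case (Cons p w)
  then show ?case using R_closed by (cases p) auto
qed simp

subsection \<open>The free left action of a factor\<close>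

text \<open>
  A basis of \<open>G\<close> as a left \<open>A i\<close>-set: words whose first letter could be absorbed into a coefficient
  in \<open>A i\<close> are left out.
\<close>

definition T :: "bool \<Rightarrow> 'a set"
  where "T i = {wprod w | w. alt (\<not> i) w}"

lemma T_closed: "t \<in> T i \<Longrightarrow> t \<in> carrier G"
  using alt_closed by (auto simp: T_def)

lemma one_T: "\<one> \<in> T i"
  unfolding T_def by (rule CollectI, rule exI[of _ "[]"]) simp

lemma word_decomposition:
  assumes n: "n \<in> N" and w: "alt j w"
  obtains x t where "x \<in> A i" "t \<in> T i" "n \<otimes> wprod w = x \<otimes> t"
proof (cases "w \<noteq> [] \<and> j = i")
  case True
  then obtain r v where rv: "w = (i, r) # v" "r \<in> R i" "alt (\<not> i) v"
    using w by (cases w) auto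
  have "n \<otimes> wprod w = (n \<otimes> r) \<otimes> wprod v"
    using rv n alt_closed R_closed N_closed by (simp add: m_assoc)
  moreover have "wprod v \<in> T i" using rv by (auto simp: T_def)
  moreover have "n \<otimes> r \<in> A i" using rv n N_A A_mult R_A by blast
  ultimately show thesis using that by blast
next
  case False
  then have "alt (\<not> i) w" using w by (cases w; cases i; cases j) auto
  then have "wprod w \<in> T i" by (auto simp: T_def)
  then show thesis using that n N_A by blast
qed

lemma decomposition_word:
  assumes x: "x \<in> A i" and t: "t \<in> T i"
  obtains n j w where "n \<in> N" "alt j w" "x \<otimes> t = n \<otimes> wprod w"
proof -
  obtain w where w: "alt (\<not> i) w" "t = wprod w" using t by (auto simp: T_def)
  from x show thesis
  proof (cases rule: A_decomposition)
    case 1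
    then show thesis using that w by blast
  next
    case (2 n r)
    have "alt i ((i, r) # w)" using 2 w by simp
    moreover have "x \<otimes> t = n \<otimes> wprod ((i, r) # w)"
      using 2 w alt_closed R_closed N_closed by (simp add: m_assoc)
    ultimately show thesis using that 2 by blast
  qed
qed

lemma normal_form:
  assumes "a \<in> carrier G"
  obtains n j w where "n \<in> N" "alt j w" "a = n \<otimes> wprod w"
proof -
  have "carrier G \<subseteq> {a. \<exists>n\<in>N. \<exists>j w. alt j w \<and> a = n \<otimes> wprod w}"
  proof (rule generated)
    show "\<one> \<in> {a. \<exists>n\<in>N. \<exists>j w. alt j w \<and> a = n \<otimes> wprod w}"
      using N_one by (auto intro!: bexI[of _ \<one>] exI[of _ "[]"])
  next
    fix i x b
    assume x: "x \<in> A i" and "b \<in> {a. \<exists>n\<in>N. \<exists>j w. alt j w \<and> a = n \<otimes> wprod w}"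
    then obtain m k v where "m \<in> N" "alt k v" "b = m \<otimes> wprod v" by blast
    then obtain y t where yt: "y \<in> A i" "t \<in> T i" "b = y \<otimes> t"
      using word_decomposition[of m k v i] by metis
    then obtain n j w where "n \<in> N" "alt j w" "(x \<otimes> y) \<otimes> t = n \<otimes> wprod w"
      using decomposition_word[of "x \<otimes> y" i t] A_mult[OF x] by metis
    moreover have "x \<otimes> b = (x \<otimes> y) \<otimes> t" using x yt A_closed T_closed by (simp add: m_assoc)
    ultimately show "x \<otimes> b \<in> {a. \<exists>n\<in>N. \<exists>j w. alt j w \<and> a = n \<otimes> wprod w}" by auto
  qed
  then show thesis using that assms by blast
qed

lemma decomposition:
  assumes "a \<in> carrier G"
  obtains x t where "x \<in> A i" "t \<in> T i" "a = x \<otimes> t"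
proof -
  obtain n j w where "n \<in> N" "alt j w" "a = n \<otimes> wprod w" using normal_form[OF assms] by blast
  then show thesis using word_decomposition[of n j w i] that by metis
qed

lemma decomposition_unique:
  assumes x: "x \<in> A i" and y: "y \<in> A i" and t: "t \<in> T i" and u: "u \<in> T i"
    and eq: "x \<otimes> t = y \<otimes> u"
  shows "x = y \<and> t = u"
proof -
  have unique: "\<lbrakk>n \<in> N; m \<in> N; alt k w; alt j v; n \<otimes> wprod w = m \<otimes> wprod v\<rbrakk> \<Longrightarrow> n = m \<and> w = v"
    for n m k j w v
    unfolding R_def[abs_def] by (rule normal_form_unique)
  have nf: "\<exists>n\<in>N. \<exists>v. x = n \<otimes> wprod v \<and> x \<otimes> wprod w = n \<otimes> wprod (v @ w) \<and>
      (v = [] \<and> alt (\<not> i) (v @ w) \<or> (\<exists>r. v = [(i, r)]) \<and> alt i (v @ w))"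
    if "x \<in> A i" "alt (\<not> i) w" for x w
    using that(1)
  proof (cases rule: A_decomposition)
    case 1
    then show ?thesis using that N_closed by (auto intro!: bexI[of _ x] exI[of _ "[]"])
  next
    case (2 n r)
    then show ?thesis using that N_closed R_A[of r i] A_closed alt_closed[OF that(2)]
      by (auto intro!: bexI[of _ n] exI[of _ "[(i, r)]"] simp: m_assoc)
  qed
  obtain w v where w: "alt (\<not> i) w" "t = wprod w" and v: "alt (\<not> i) v" "u = wprod v"
    using t u by (auto simp: T_def)
  obtain n w' where n: "n \<in> N" "x = n \<otimes> wprod w'" "x \<otimes> t = n \<otimes> wprod (w' @ w)"
    "w' = [] \<and> alt (\<not> i) (w' @ w) \<or> (\<exists>r. w' = [(i, r)]) \<and> alt i (w' @ w)"
    using nf[OF x w(1)] w(2) by blast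
  obtain m v' where m: "m \<in> N" "y = m \<otimes> wprod v'" "y \<otimes> u = m \<otimes> wprod (v' @ v)"
    "v' = [] \<and> alt (\<not> i) (v' @ v) \<or> (\<exists>r. v' = [(i, r)]) \<and> alt i (v' @ v)"
    using nf[OF y v(1)] v(2) by blast
  have *: "n = m" "w' @ w = v' @ v"
    using unique[of n m _ "w' @ w" _ "v' @ v"] n m eq by metis+
  \<comment> \<open>The first letters of \<open>w\<close> and \<open>v\<close> have the wrong side for \<open>w'\<close> and \<open>v'\<close>.\<close>
  have "w' = v'" "w = v"
    using *(2) n(4) m(4) w(1) v(1) by (cases w; cases v; auto)+
  then show ?thesis using * n m w v by simp
qed

text \<open>
  Writing \<open>b = c u\<close> in basis form, \<open>(y c) u = x t\<close> forces \<open>y c = x\<close> and \<open>u = t\<close>. Hence \<open>x\<close> is the greatest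
  left divisor of \<open>x t\<close> in \<open>A i\<close>, and (for \<open>t = \<one>\<close>) cofactors of left divisors within \<open>A i\<close> stay in \<open>A i\<close>.
\<close>

lemma A_left_divisor:
  assumes "x \<in> A i" "t \<in> T i" "y \<in> A i" "b \<in> carrier G" "y \<otimes> b = x \<otimes> t"
  obtains c where "c \<in> A i" "x = y \<otimes> c" "b = c \<otimes> t"
proof -
  obtain c u where c: "c \<in> A i" "u \<in> T i" "b = c \<otimes> u" using decomposition[OF assms(4)] by blast
  have "(y \<otimes> c) \<otimes> u = x \<otimes> t" using c assms A_closed T_closed by (simp add: m_assoc)
  then have "y \<otimes> c = x \<and> u = t"
    using decomposition_unique[of "y \<otimes> c" i x u t] c assms A_mult by blast
  then show thesis using that c by blast
qed

lemma A_left_cancel: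
  assumes "x \<in> A i" "a \<in> carrier G" "b \<in> carrier G" "x \<otimes> a = x \<otimes> b"
  shows "a = b"
proof -
  interpret F: parabolic_in_preGarside N "G\<lparr>carrier := A i\<rparr>" by (rule factor)
  obtain c t where c: "c \<in> A i" "t \<in> T i" "b = c \<otimes> t" using decomposition[OF assms(3)] by blast
  have "x \<otimes> a = (x \<otimes> c) \<otimes> t" using c assms A_closed T_closed by (simp add: m_assoc)
  then obtain d where d: "d \<in> A i" "x \<otimes> c = x \<otimes> d" "a = d \<otimes> t"
    using A_left_divisor[of "x \<otimes> c" i t x a] c assms A_mult by metis
  then have "c = d" using F.left_cancel[of x c d] c assms by simp
  then show ?thesis using c d by simp
qed

lemma generation_induct [consumes 1, case_names one mult]:
  assumes "a \<in> carrier G" and "P \<one>"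
    and "\<And>i x b. \<lbrakk>x \<in> A i; b \<in> carrier G; P b\<rbrakk> \<Longrightarrow> P (x \<otimes> b)"
  shows "P a"
proof -
  have "carrier G \<subseteq> {a \<in> carrier G. P a}"
    by (rule generated) (use assms A_closed in auto)
  then show ?thesis using assms(1) by blast
qed

lemma left_cancel:
  assumes "c \<in> carrier G" "a \<in> carrier G" "b \<in> carrier G" "c \<otimes> a = c \<otimes> b"
  shows "a = b"
  using assms
proof (induction c arbitrary: a b rule: generation_induct)
  case (mult i x c)
  then have "x \<otimes> (c \<otimes> a) = x \<otimes> (c \<otimes> b)" using A_closed by (simp add: m_assoc)
  then have "c \<otimes> a = c \<otimes> b" using A_left_cancel[of x i "c \<otimes> a" "c \<otimes> b"] mult(1,2) mult.prems(1,2) by simp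
  then show ?case using mult.IH mult.prems(1,2) by blast
qed simp

text \<open>
  If the normal form \<open>n r\<^sub>1 \<dots> r\<^sub>k\<close> begins on one side, the greatest left divisor on the other side is \<open>n\<close>.
  This is why two elements outside \<open>N\<close>, one from each factor, have no common multiple.
\<close>

lemma divisor_sides:
  assumes "a \<in> carrier G"
  obtains i where "\<And>y b. \<lbrakk>y \<in> A i; b \<in> carrier G; a = y \<otimes> b\<rbrakk> \<Longrightarrow> y \<in> N"
proof -
  obtain n j w where nf: "n \<in> N" "alt j w" "a = n \<otimes> wprod w" using normal_form[OF assms] by blast
  then have t: "wprod w \<in> T (\<not> j)" by (auto simp: T_def)
  have "y \<in> N" if y: "y \<in> A (\<not> j)" "b \<in> carrier G" "a = y \<otimes> b" for y b
  proof -
    obtain c where "c \<in> A (\<not> j)" "n = y \<otimes> c"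
      using A_left_divisor[of n "\<not> j" "wprod w" y b] t y nf N_A by metis
    then show ?thesis using N_factors[of y c] nf y by blast
  qed
  then show thesis using that by blast
qed

subsection \<open>Joins\<close>

lemma left_joinI:
  assumes "a \<in> carrier G" "b \<in> carrier G" "a' \<in> carrier G" "b' \<in> carrier G" "a \<otimes> b' = b \<otimes> a'"
    and "\<And>u v. \<lbrakk>u \<in> carrier G; v \<in> carrier G; a \<otimes> u = b \<otimes> v\<rbrakk> \<Longrightarrow> \<exists>z\<in>carrier G. a \<otimes> u = a \<otimes> b' \<otimes> z"
  shows "is_left_join G a b (a \<otimes> b')"
proof -
  have "a divides (a \<otimes> b')" "b divides (a \<otimes> b')"
    unfolding factor_def using assms(3-5) by blast+
  moreover have "(a \<otimes> b') divides y" if "y \<in> carrier G" "a divides y" "b divides y" for y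
    using that assms(6) unfolding factor_def by metis
  ultimately show ?thesis using assms(1,4) by (simp add: is_left_join_def islcm_def)
qed

text \<open>
  Any common multiple of \<open>x, y \<in> A i\<close> is a multiple of one inside \<open>A i\<close>, namely of its greatest
  left divisor there, so the join computed in \<open>A i\<close> is a join in \<open>G\<close>.
\<close>

lemma A_left_join:
  assumes xy: "x \<in> A i" "y \<in> A i" and uv: "u \<in> carrier G" "v \<in> carrier G" "x \<otimes> u = y \<otimes> v"
  obtains x' y' where "x' \<in> A i" "y' \<in> A i" "x \<otimes> y' = y \<otimes> x'" "is_left_join G x y (x \<otimes> y')"
proof -
  have common: "\<exists>u'\<in>A i. \<exists>v'\<in>A i. \<exists>t\<in>carrier G. x \<otimes> u' = y \<otimes> v' \<and> u = u' \<otimes> t"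
    if uv: "u \<in> carrier G" "v \<in> carrier G" "x \<otimes> u = y \<otimes> v" for u v
  proof -
    obtain u' t where u': "u' \<in> A i" "t \<in> T i" "u = u' \<otimes> t" using decomposition[OF uv(1)] by blast
    have xu': "x \<otimes> u' \<in> A i" using xy u' A_mult by blast
    have "y \<otimes> v = (x \<otimes> u') \<otimes> t"
      unfolding uv(3)[symmetric] u'(3) using u' xy A_closed T_closed by (simp add: m_assoc)
    then obtain v' where "v' \<in> A i" "x \<otimes> u' = y \<otimes> v'"
      using A_left_divisor[OF xu' u'(2) xy(2) uv(2)] by blast
    then show ?thesis using u' T_closed by blast
  qed
  obtain u' v' where "u' \<in> A i" "v' \<in> A i" "x \<otimes> u' = y \<otimes> v'" using common uv by blast
  then obtain x' y' where *: "x' \<in> A i" "y' \<in> A i" "x \<otimes> y' = y \<otimes> x'"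
    and least: "\<And>u v. \<lbrakk>u \<in> A i; v \<in> A i; x \<otimes> u = y \<otimes> v\<rbrakk> \<Longrightarrow> \<exists>z\<in>A i. x \<otimes> u = x \<otimes> y' \<otimes> z"
    using A_join[OF xy, of u' v'] by blast
  have "is_left_join G x y (x \<otimes> y')"
  proof (rule left_joinI)
    fix u v assume "u \<in> carrier G" "v \<in> carrier G" "x \<otimes> u = y \<otimes> v"
    then obtain u' v' t where u': "u' \<in> A i" "v' \<in> A i" "t \<in> carrier G" "x \<otimes> u' = y \<otimes> v'" "u = u' \<otimes> t"
      using common by blast
    then obtain z where z: "z \<in> A i" "x \<otimes> u' = x \<otimes> y' \<otimes> z" using least by blast
    have cl: "x \<in> carrier G" "y' \<in> carrier G" "z \<in> carrier G" "u' \<in> carrier G"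
      using xy * z u' A_closed by blast+
    have "x \<otimes> u = (x \<otimes> u') \<otimes> t" unfolding u'(5) using cl u'(3) by (simp add: m_assoc)
    also have "\<dots> = x \<otimes> y' \<otimes> (z \<otimes> t)" unfolding z(2) using cl u'(3) by (simp add: m_assoc)
    finally show "\<exists>z\<in>carrier G. x \<otimes> u = x \<otimes> y' \<otimes> z" using cl u'(3) by blast
  qed (use xy * A_closed in auto)
  then show thesis using that[of x' y'] * by blast
qed

lemma generator_left_join:
  assumes xy: "x \<in> A i" "y \<in> A j" and uv: "u \<in> carrier G" "v \<in> carrier G" "x \<otimes> u = y \<otimes> v"
  obtains k x' y' where "x' \<in> A k" "y' \<in> A k" "x \<otimes> y' = y \<otimes> x'" "is_left_join G x y (x \<otimes> y')"
proof -
  have "x \<otimes> u \<in> carrier G" using xy uv A_closed by blast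
  then obtain k where k: "\<And>z b. \<lbrakk>z \<in> A k; b \<in> carrier G; x \<otimes> u = z \<otimes> b\<rbrakk> \<Longrightarrow> z \<in> N"
    using divisor_sides by blast
  have "(x \<in> A i \<and> y \<in> A i) \<or> (x \<in> A j \<and> y \<in> A j)"
  proof (cases "i = j")
    case False
    then have "k = i \<or> k = j" by auto
    then show ?thesis using k[of x u] k[of y v] xy uv N_A by blast
  qed (use xy in blast)
  then show thesis using A_left_join[of x _ y u v] uv that by metis
qed

text \<open>
  Two adjacent squares of the grid, one for \<open>a\<close> and \<open>t\<close> and the next for the complement \<open>a'\<close> and \<open>b\<close>,
  compose to a square for \<open>a\<close> and \<open>t b\<close>.
\<close>

lemma left_join_mult:
  assumes c: "a \<in> carrier G" "t \<in> carrier G" "a' \<in> carrier G" "b \<in> carrier G"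
    and s: "is_left_join G a t (t \<otimes> a')" and s': "is_left_join G a' b s'"
  shows "is_left_join G a (t \<otimes> b) (t \<otimes> s')"
proof -
  have s'c: "s' \<in> carrier G" using s' by (simp add: is_left_join_def)
  obtain p where p: "p \<in> carrier G" "t \<otimes> a' = a \<otimes> p" using s by (auto simp: is_left_join_def islcm_def factor_def)
  obtain q where q: "q \<in> carrier G" "s' = a' \<otimes> q" using s' by (auto simp: is_left_join_def islcm_def factor_def)
  obtain r where r: "r \<in> carrier G" "s' = b \<otimes> r" using s' by (auto simp: is_left_join_def islcm_def factor_def)
  have "t \<otimes> s' = a \<otimes> (p \<otimes> q)" using p q c by (simp flip: m_assoc)
  then have "a divides (t \<otimes> s')" using p q unfolding factor_def by blast
  moreover have "(t \<otimes> b) divides (t \<otimes> s')" using r c unfolding factor_def by (auto simp: m_assoc)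
  moreover have "(t \<otimes> s') divides y" if y: "y \<in> carrier G" "a divides y" "(t \<otimes> b) divides y" for y
  proof -
    obtain z where z: "z \<in> carrier G" "y = t \<otimes> (b \<otimes> z)" using y c by (auto simp: factor_def m_assoc)
    then have "t divides y" using c unfolding factor_def by blast
    then have "(t \<otimes> a') divides y" using s y by (simp add: is_left_join_def islcm_def)
    then obtain z' where z': "z' \<in> carrier G" "y = t \<otimes> (a' \<otimes> z')" using c by (auto simp: factor_def m_assoc)
    have "b \<otimes> z = a' \<otimes> z'" using left_cancel[of t "b \<otimes> z" "a' \<otimes> z'"] z z' c by simp
    then have "s' divides (b \<otimes> z)"
      using s' z z' c unfolding is_left_join_def islcm_def factor_def by blast
    then show ?thesis using z c s'c by (auto simp: factor_def m_assoc)
  qed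
  ultimately show ?thesis using c s'c by (simp add: is_left_join_def islcm_def)
qed

text \<open>
  A row of the grid. The induction goes through because the complement \<open>x'\<close> of a generator \<open>x\<close> against
  a generator is again a generator; the conclusion therefore records that \<open>x'\<close> lies in some factor.
\<close>

lemma generator_any_left_join:
  assumes "b \<in> carrier G" "x \<in> A i" "u \<in> carrier G" "v \<in> carrier G" "x \<otimes> u = b \<otimes> v"
  shows "\<exists>b'\<in>carrier G. \<exists>k. \<exists>x'\<in>A k. x \<otimes> b' = b \<otimes> x' \<and> is_left_join G x b (b \<otimes> x')"
  using assms
proof (induction b arbitrary: x i u v rule: generation_induct)
  case one
  then have "is_left_join G x \<one> (x \<otimes> \<one>)"
    using A_closed by (intro left_joinI[where a' = x]) auto
  then show ?case using one A_closed by (intro bexI[of _ \<one>] exI[of _ i] bexI[of _ x]) auto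
next
  case (mult j y b)
  have bv: "y \<otimes> (b \<otimes> v) = x \<otimes> u" using mult A_closed by (simp add: m_assoc)
  obtain k x' y' where j: "x' \<in> A k" "y' \<in> A k" "x \<otimes> y' = y \<otimes> x'" "is_left_join G x y (x \<otimes> y')"
    using generator_left_join[of x i y j u "b \<otimes> v"] mult bv by (metis m_closed)
  have "(y \<otimes> x') divides (x \<otimes> u)"
    using j mult bv A_closed unfolding is_left_join_def islcm_def factor_def
    by (metis m_closed)
  then obtain z where z: "z \<in> carrier G" "x \<otimes> u = y \<otimes> x' \<otimes> z" unfolding factor_def by blast
  then have "x \<otimes> u = y \<otimes> (x' \<otimes> z)" using j(1) mult(1) A_closed by (simp add: m_assoc)
  then have "x' \<otimes> z = b \<otimes> v"
    using A_left_cancel[of y j "x' \<otimes> z" "b \<otimes> v"] A_closed[OF j(1)] z(1) mult(1,2) mult.prems bv by simp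
  then obtain b' l x'' where b': "b' \<in> carrier G" "x'' \<in> A l" "x' \<otimes> b' = b \<otimes> x''"
    "is_left_join G x' b (b \<otimes> x'')"
    using mult.IH[of x' k z v] j z mult by blast
  have cl: "x \<in> carrier G" "y \<in> carrier G" "x' \<in> carrier G" "y' \<in> carrier G" "x'' \<in> carrier G"
    "b \<in> carrier G" "b' \<in> carrier G"
    using j b' mult A_closed by blast+
  have "is_left_join G x (y \<otimes> b) (y \<otimes> (b \<otimes> x''))"
    using left_join_mult[of x y x' b "b \<otimes> x''"] j b' mult A_closed by auto
  moreover have "x \<otimes> (y' \<otimes> b') = (y \<otimes> b) \<otimes> x''"
  proof -
    have "x \<otimes> (y' \<otimes> b') = (x \<otimes> y') \<otimes> b'" using cl by (simp add: m_assoc)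
    also have "\<dots> = y \<otimes> (x' \<otimes> b')" unfolding j(3) using cl by (simp add: m_assoc)
    also have "\<dots> = (y \<otimes> b) \<otimes> x''" unfolding b'(3) using cl by (simp add: m_assoc)
    finally show ?thesis .
  qed
  moreover have "y' \<otimes> b' \<in> carrier G" "y \<otimes> (b \<otimes> x'') = (y \<otimes> b) \<otimes> x''"
    using cl by (simp_all add: m_assoc)
  ultimately show ?case using b' by metis
qed

lemma is_left_join_commute: "is_left_join G a b s \<longleftrightarrow> is_left_join G b a s"
  by (auto simp: is_left_join_def islcm_def)

lemma ex_left_join:
  assumes "a \<in> carrier G" "b \<in> carrier G" "u \<in> carrier G" "v \<in> carrier G" "a \<otimes> u = b \<otimes> v"
  shows "\<exists>s. is_left_join G a b s"
  using assms
proof (induction a arbitrary: b u v rule: generation_induct)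
  case one
  then have "is_left_join G \<one> b (\<one> \<otimes> b)" by (intro left_joinI[where a' = \<one>]) auto
  then show ?case ..
next
  case (mult i x a)
  have xu: "x \<otimes> (a \<otimes> u) = b \<otimes> v" using mult A_closed by (simp add: m_assoc)
  obtain b' k x' where j: "b' \<in> carrier G" "x' \<in> A k" "x \<otimes> b' = b \<otimes> x'" "is_left_join G x b (b \<otimes> x')"
    using generator_any_left_join[of b x i "a \<otimes> u" v] mult xu by (metis m_closed)
  have "(x \<otimes> b') divides (b \<otimes> v)"
    using j mult xu unfolding is_left_join_def islcm_def factor_def by (metis m_closed)
  then obtain z where z: "z \<in> carrier G" "b \<otimes> v = x \<otimes> b' \<otimes> z" unfolding factor_def by blast
  then have "b \<otimes> v = x \<otimes> (b' \<otimes> z)" using j(1) mult(1) A_closed by (simp add: m_assoc)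
  then have "a \<otimes> u = b' \<otimes> z"
    using A_left_cancel[of x i "a \<otimes> u" "b' \<otimes> z"] j(1) z(1) mult(1,2) mult.prems xu by simp
  then obtain s where "is_left_join G a b' s" using mult.IH[of b' u z] j z mult by blast
  then have "is_left_join G b (x \<otimes> a) (x \<otimes> s)"
    using left_join_mult[of b x b' a s] j mult A_closed is_left_join_commute by metis
  then show ?case using is_left_join_commute by blast
qed

subsection \<open>Bounded factorizations\<close>

definition factorization :: "'a list \<Rightarrow> 'a \<Rightarrow> bool"
  where "factorization us a \<longleftrightarrow> set us \<subseteq> (\<Union>i. A i) - {\<one>} \<and> foldr (\<otimes>) us \<one> = a"

lemma factorization_Nil [simp]: "factorization [] a \<longleftrightarrow> a = \<one>"
  by (auto simp: factorization_def)

lemma factorization_Cons: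
  "factorization (g # us) a \<longleftrightarrow>
    (\<exists>i. g \<in> A i) \<and> g \<noteq> \<one> \<and> (\<exists>b. factorization us b \<and> a = g \<otimes> b)"
  by (auto simp: factorization_def)

lemma factorization_closed: "factorization us a \<Longrightarrow> a \<in> carrier G"
  by (induction us arbitrary: a) (auto simp: factorization_Cons dest: A_closed)

lemma factorization_append:
  "factorization us a \<Longrightarrow> factorization vs b \<Longrightarrow> factorization (us @ vs) (a \<otimes> b)"
proof (induction us arbitrary: a)
  case Nil
  then show ?case by (simp add: factorization_closed)
next
  case (Cons g us)
  then obtain i c where c: "g \<in> A i" "g \<noteq> \<one>" "factorization us c" "a = g \<otimes> c"
    by (auto simp: factorization_Cons)
  then have "a \<otimes> b = g \<otimes> (c \<otimes> b)"
    using Cons factorization_closed A_closed by (simp add: m_assoc)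
  then show ?case using Cons c by (auto simp: factorization_Cons)
qed

lemma ex_factorization:
  assumes "a \<in> carrier G"
  shows "\<exists>us. factorization us a"
  using assms
proof (induction a rule: generation_induct)
  case (mult i x b)
  then obtain us where us: "factorization us b" by blast
  show ?case
  proof (cases "x = \<one>")
    case False
    then have "factorization (x # us) (x \<otimes> b)" using us mult by (auto simp: factorization_Cons)
    then show ?thesis ..
  qed (use us mult in auto)
qed (auto intro: exI[of _ "[]"])

definition bounded :: "'a \<Rightarrow> bool"
  where "bounded a \<longleftrightarrow> (\<exists>B. \<forall>us. factorization us a \<longrightarrow> length us \<le> B)"

text \<open>
  Divisors of elements of \<open>N\<close> lie in \<open>N\<close>, so factorizations of \<open>n \<in> N\<close> take place inside \<open>A True\<close>,
  whose norm bounds them.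
\<close>

lemma bounded_N: "n \<in> N \<Longrightarrow> bounded n"
proof -
  obtain \<nu> :: "'a \<Rightarrow> nat" where pos: "\<And>x. \<lbrakk>x \<in> A True; x \<noteq> \<one>\<rbrakk> \<Longrightarrow> 0 < \<nu> x"
    and \<nu>: "\<And>x y. \<lbrakk>x \<in> A True; y \<in> A True\<rbrakk> \<Longrightarrow> \<nu> x + \<nu> y \<le> \<nu> (x \<otimes> y)"
    using A_norm by blast
  have "length us \<le> \<nu> n" if "factorization us n" "n \<in> N" for us n
    using that
  proof (induction us arbitrary: n)
    case (Cons g us)
    then obtain i b where b: "g \<in> A i" "g \<noteq> \<one>" "factorization us b" "n = g \<otimes> b"
      by (auto simp: factorization_Cons)
    obtain c where c: "c \<in> A i" "n = g \<otimes> c" "b = c \<otimes> \<one>"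
      using A_left_divisor[of n i \<one> g b] b Cons N_A N_closed one_T factorization_closed
      by (metis r_one)
    then have N: "g \<in> N" "c \<in> N" "b = c" using N_factors[of g c] b Cons A_closed by auto
    then have "length us \<le> \<nu> c" "0 < \<nu> g" "\<nu> g + \<nu> c \<le> \<nu> n"
      using Cons.IH b c pos[of g] \<nu>[of g c] N_A by auto
    then show ?case by simp
  qed simp
  then show "n \<in> N \<Longrightarrow> bounded n" by (auto simp: bounded_def)
qed

text \<open>
  Split a factorization of \<open>x t\<close> where it leaves \<open>A i\<close>. The initial part is a left divisor of \<open>x\<close>, so its
  length is at most the norm of \<open>x\<close>. The remainder, if there is one, is \<open>z t\<close> with \<open>z \<in> A i\<close> a right divisor of \<open>x\<close>, and it
  begins with a generator outside \<open>A i\<close>; this forces \<open>z \<in> N\<close>. All these \<open>z\<close> divide one \<open>d \<in> N\<close> on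
  the right, so one bound, that of \<open>d t\<close>, serves for all of them.
\<close>

lemma bounded_step:
  assumes x: "x \<in> A i" and t: "t \<in> T i" and IH: "\<And>n. n \<in> N \<Longrightarrow> bounded (n \<otimes> t)"
  shows "bounded (x \<otimes> t)"
proof -
  obtain \<nu> :: "'a \<Rightarrow> nat" where pos: "\<And>x. \<lbrakk>x \<in> A i; x \<noteq> \<one>\<rbrakk> \<Longrightarrow> 0 < \<nu> x"
    and \<nu>: "\<And>x y. \<lbrakk>x \<in> A i; y \<in> A i\<rbrakk> \<Longrightarrow> \<nu> x + \<nu> y \<le> \<nu> (x \<otimes> y)"
    using A_norm by blast
  obtain d where d: "d \<in> N" and max: "\<And>y b. \<lbrakk>y \<in> A i; b \<in> N; x = y \<otimes> b\<rbrakk> \<Longrightarrow> \<exists>c\<in>N. d = c \<otimes> b"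
    using A_greatest_right_N_divisor[OF x] by blast
  obtain B where B: "\<And>us. factorization us (d \<otimes> t) \<Longrightarrow> length us \<le> B"
    using IH[OF d] by (auto simp: bounded_def)
  have N_case: "length us \<le> B"
    if us: "factorization us (b \<otimes> t)" and b: "b \<in> N" "y \<in> A i" "x = y \<otimes> b" for us b y
  proof -
    obtain c where c: "c \<in> N" "d = c \<otimes> b" using max b by blast
    show ?thesis
    proof (cases "c = \<one>")
      case True
      then show ?thesis using B us c b N_closed by simp
    next
      case False
      have "factorization (c # us) (d \<otimes> t)"
        using us c b False N_A N_closed T_closed[OF t]
        by (auto simp: factorization_Cons m_assoc)
      from B[OF this] show ?thesis by simp
    qed
  qed
  \<comment> \<open>The norm pays for the generators in \<open>A i\<close>, and \<open>B\<close> for all those that come after \<open>z\<close> has dropped into \<open>N\<close>.\<close>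
  have "length us \<le> \<nu> z + B"
    if "factorization us (z \<otimes> t)" "z \<in> A i" "y \<in> A i" "x = y \<otimes> z" for us z y
    using that
  proof (induction us arbitrary: z y)
    case (Cons g us)
    then obtain j b where b: "g \<in> A j" "g \<noteq> \<one>" "factorization us b" "z \<otimes> t = g \<otimes> b"
      by (auto simp: factorization_Cons)
    note bc = factorization_closed[OF b(3)]
    show ?case
    proof (cases "z \<in> N")
      case True
      then show ?thesis using N_case[of "g # us" z y] Cons by simp
    next
      case False
      \<comment> \<open>A generator of the other factor would divide the \<open>N\<close>-part of \<open>z\<close>, hence lie in \<open>N\<close>.\<close>
      have "g \<in> A i"
      proof (cases "j = i")
        case False
        obtain n r where nr: "n \<in> N" "r \<in> R i" "z = n \<otimes> r"
          using \<open>z \<in> A i\<close> \<open>z \<notin> N\<close> by (cases rule: A_decomposition) auto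
        obtain w where w: "alt (\<not> i) w" "t = wprod w" using t by (auto simp: T_def)
        have "alt (\<not> j) ((i, r) # w)" using w nr False by auto
        then have "wprod ((i, r) # w) \<in> T j" unfolding T_def by blast
        moreover have "n \<otimes> wprod ((i, r) # w) = g \<otimes> b"
          using nr w b(4) alt_closed R_closed N_closed by (simp add: m_assoc)
        ultimately obtain c where "c \<in> A j" "n = g \<otimes> c"
          using A_left_divisor[of n j _ g b] b bc nr N_A by metis
        then have "g \<in> N" using N_factors[of g c] nr b by blast
        then show ?thesis by (rule N_A)
      qed (use b in simp)
      then obtain c where c: "c \<in> A i" "z = g \<otimes> c" "b = c \<otimes> t"
        using A_left_divisor[of z i t g b] Cons t b bc by metis
      have "x = (y \<otimes> g) \<otimes> c" "y \<otimes> g \<in> A i"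
        using c Cons \<open>g \<in> A i\<close> A_closed A_mult by (simp_all add: m_assoc)
      then have "length us \<le> \<nu> c + B" using Cons.IH[of c "y \<otimes> g"] b c by simp
      moreover have "0 < \<nu> g" "\<nu> g + \<nu> c \<le> \<nu> z" using pos \<nu> \<open>g \<in> A i\<close> b c by auto
      ultimately show ?thesis by simp
    qed
  qed simp
  from this[of _ x \<one>] show ?thesis
    unfolding bounded_def using x A_one A_closed by (intro exI[of _ "\<nu> x + B"]) simp
qed

lemma bounded_all:
  assumes "a \<in> carrier G"
  shows "bounded a"
proof -
  have "bounded (n \<otimes> wprod w)" if "n \<in> N" "alt i w" for n i w
    using that
  proof (induction w arbitrary: i n)
    case Nil
    then show ?case using bounded_N N_closed by simp
  next
    case (Cons p w)
    then obtain r where r: "p = (i, r)" "r \<in> R i" "alt (\<not> i) w" by (cases p) auto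
    have "n \<otimes> r \<in> A i" using Cons r N_A A_mult R_A by blast
    moreover have "wprod w \<in> T i" using r by (auto simp: T_def)
    ultimately have "bounded ((n \<otimes> r) \<otimes> wprod w)" using bounded_step Cons.IH r(3) by blast
    then show ?case using r Cons.prems R_closed N_closed alt_closed by (simp add: m_assoc)
  qed
  then show ?thesis using normal_form[OF assms] by metis
qed

lemma ex_norm:
  "\<exists>\<nu> :: 'a \<Rightarrow> nat. (\<forall>a\<in>carrier G. a \<noteq> \<one> \<longrightarrow> \<nu> a > 0) \<and>
    (\<forall>a\<in>carrier G. \<forall>b\<in>carrier G. \<nu> (a \<otimes> b) \<ge> \<nu> a + \<nu> b)"
proof -
  define \<nu> where "\<nu> a = (GREATEST k. \<exists>us. factorization us a \<and> length us = k)" for a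
  have le: "length us \<le> \<nu> a" if us: "factorization us a" for us a
  proof -
    obtain B where B: "\<And>us. factorization us a \<Longrightarrow> length us \<le> B"
      using bounded_all factorization_closed us unfolding bounded_def by blast
    show ?thesis unfolding \<nu>_def by (rule Greatest_le_nat[of _ _ B]) (use us B in auto)
  qed
  have attained: "\<exists>us. factorization us a \<and> length us = \<nu> a" if a: "a \<in> carrier G" for a
  proof -
    obtain B where B: "\<And>us. factorization us a \<Longrightarrow> length us \<le> B"
      using bounded_all a unfolding bounded_def by blast
    obtain us where us: "factorization us a" using ex_factorization a by blast
    show ?thesis unfolding \<nu>_def by (rule GreatestI_nat[of _ "length us" B]) (use us B in auto)
  qed
  show ?thesis
  proof (intro exI[of _ \<nu>] conjI ballI impI)
    fix a assume "a \<in> carrier G" "a \<noteq> \<one>"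
    then obtain us where "factorization us a" "us \<noteq> []"
      using ex_factorization[of a] by (metis factorization_Nil)
    then show "0 < \<nu> a" using le[of us a] by (cases us) auto
  next
    fix a b assume "a \<in> carrier G" "b \<in> carrier G"
    then obtain us vs where "factorization us a" "length us = \<nu> a" "factorization vs b" "length vs = \<nu> b"
      using attained by blast
    then show "\<nu> a + \<nu> b \<le> \<nu> (a \<otimes> b)" using le[OF factorization_append[of us a vs b]] by simp
  qed
qed

lemma left_preGarside: "left_preGarside_monoid G"
proof
  show "a = b" if "c \<otimes> a = c \<otimes> b" "a \<in> carrier G" "b \<in> carrier G" "c \<in> carrier G" for a b c
    using left_cancel that by blast
  show "\<exists>s. is_left_join G a b s"
    if "a \<in> carrier G" "b \<in> carrier G" "\<exists>m\<in>carrier G. a divides m \<and> b divides m" for a b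
    using that ex_left_join unfolding factor_def by blast
qed (rule ex_norm)

end

section \<open>The action on normal forms\<close>

text \<open>
  One factor \<open>M\<close> acting on pairs \<open>(n, w)\<close>, where \<open>n\<close> is an element of the common submonoid and \<open>w\<close> a
  word in letters from both factors; \<open>e\<close> tags the letters from \<open>M\<close>. The set \<open>V\<close> of admissible
  words is constrained only by the rule for prefixing \<open>M\<close>-letters, which leaves room for letters of
  the other factor; so both factors act on the same set of states.
\<close>

locale normal_form_action = parabolic_in_preGarside H M for H and M (structure) +
  fixes N :: "('n, 'z) monoid_scheme" and \<iota> :: "'n \<Rightarrow> 'a" and e :: "'a \<Rightarrow> 'c" and V :: "'c list set"
  assumes monoid_N: "monoid N"
    and hom: "\<iota> \<in> monoid_hom N M" and inj: "inj_on \<iota> (carrier N)"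
    and H_eq: "H = \<iota> ` carrier N"
    and inj_e: "inj e"
    and V_Cons: "e r # w \<in> V \<longleftrightarrow> r \<in> reduced \<and> r \<noteq> \<one> \<and> w \<in> V \<and> (\<forall>s v. w \<noteq> e s # v)"
begin

definition "states = carrier N \<times> V"

definition "tails = {w \<in> V. \<forall>s v. w \<noteq> e s # v}"

text \<open>
  Absorbing a leading \<open>M\<close>-letter into the coefficient turns a state into an element of \<open>M\<close> and a word
  not beginning with an \<open>M\<close>-letter. Since \<open>M\<close> is a free left \<open>H\<close>-set, this is a bijection, along which
  left multiplication on \<open>M\<close> is transported; the laws of an action are then immediate.
\<close>

definition get :: "'n \<times> 'c list \<Rightarrow> 'a \<times> 'c list"
  where "get s = (if \<exists>r v. snd s = e r # v
    then (\<iota> (fst s) \<otimes> the_inv e (hd (snd s)), tl (snd s)) else (\<iota> (fst s), snd s))"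

definition put :: "'a \<times> 'c list \<Rightarrow> 'n \<times> 'c list"
  where "put = inv_into states get"

definition act :: "'a \<Rightarrow> 'n \<times> 'c list \<Rightarrow> 'n \<times> 'c list"
  where "act x s = put (x \<otimes> fst (get s), snd (get s))"

lemma \<iota>_H: "n \<in> carrier N \<Longrightarrow> \<iota> n \<in> H"
  by (simp add: H_eq)

lemma \<iota>_closed: "n \<in> carrier N \<Longrightarrow> \<iota> n \<in> carrier M"
  by (rule in_carrier[OF \<iota>_H])

lemma reduced_closed: "r \<in> reduced \<Longrightarrow> r \<in> carrier M"
  by (simp add: reduced_def)

lemma get_eq:
  assumes "n \<in> carrier N" "r \<in> reduced" "w \<in> tails"
  shows "get (n, if r = \<one> then w else e r # w) = (\<iota> n \<otimes> r, w)"
  using assms \<iota>_closed the_inv_f_f[OF inj_e] by (auto simp: get_def tails_def)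

lemma state_cases:
  assumes "s \<in> states"
  obtains n r w where "n \<in> carrier N" "r \<in> reduced" "w \<in> tails" "s = (n, if r = \<one> then w else e r # w)"
proof (cases "\<exists>r v. snd s = e r # v")
  case True
  then obtain r v where rv: "snd s = e r # v" by blast
  then have "e r # v \<in> V" using assms by (auto simp: states_def)
  then show thesis
    using that[of "fst s" r v] rv assms unfolding V_Cons by (auto simp: states_def tails_def prod_eq_iff)
next
  case False
  then show thesis
    using that[of "fst s" \<one> "snd s"] assms one_reduced by (auto simp: states_def tails_def)
qed

lemma state_closed:
  "\<lbrakk>n \<in> carrier N; r \<in> reduced; w \<in> tails\<rbrakk> \<Longrightarrow> (n, if r = \<one> then w else e r # w) \<in> states"
  by (auto simp: states_def tails_def V_Cons)

lemma get_bij: "bij_betw get states (carrier M \<times> tails)"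
  unfolding bij_betw_def
proof (intro conjI equalityI subsetI)
  show "inj_on get states"
  proof (rule inj_onI)
    fix s s' assume s: "s \<in> states" and s': "s' \<in> states" and eq: "get s = get s'"
    obtain n r w where 1: "n \<in> carrier N" "r \<in> reduced" "w \<in> tails" "s = (n, if r = \<one> then w else e r # w)"
      using state_cases[OF s] by blast
    obtain n' r' w' where 2: "n' \<in> carrier N" "r' \<in> reduced" "w' \<in> tails"
      "s' = (n', if r' = \<one> then w' else e r' # w')"
      using state_cases[OF s'] by blast
    have "\<iota> n \<otimes> r = \<iota> n' \<otimes> r'" "w = w'" using eq get_eq 1 2 by simp_all
    then have "\<iota> n = \<iota> n' \<and> r = r'" using reduced_decomposition_unique \<iota>_H 1 2 by blast
    then show "s = s'" using inj_onD[OF inj] 1 2 \<open>w = w'\<close> by simp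
  qed
next
  fix p assume "p \<in> get ` states"
  then obtain s where s: "s \<in> states" "p = get s" by blast
  then show "p \<in> carrier M \<times> tails"
    using state_cases[OF s(1)] get_eq \<iota>_closed reduced_closed m_closed by (metis SigmaI monoid.m_closed monoid_axioms)
next
  fix p assume p: "p \<in> carrier M \<times> tails"
  then have "fst p \<in> carrier M" by auto
  then obtain n' r where "n' \<in> H" "r \<in> reduced" "fst p = n' \<otimes> r" by (rule reduced_decomposition)
  then obtain n where n: "n \<in> carrier N" "r \<in> reduced" "fst p = \<iota> n \<otimes> r" unfolding H_eq by blast
  moreover have "snd p \<in> tails" using p by auto
  ultimately have "get (n, if r = \<one> then snd p else e r # snd p) = p"
    using get_eq by (simp add: prod_eq_iff)
  then show "p \<in> get ` states" using state_closed n \<open>snd p \<in> tails\<close> by (metis (no_types) imageI)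
qed

lemma get_put: "x \<in> carrier M \<Longrightarrow> w \<in> tails \<Longrightarrow> get (put (x, w)) = (x, w)"
  and put_closed: "x \<in> carrier M \<Longrightarrow> w \<in> tails \<Longrightarrow> put (x, w) \<in> states"
  and put_get: "s \<in> states \<Longrightarrow> put (get s) = s"
  and get_closed: "s \<in> states \<Longrightarrow> get s \<in> carrier M \<times> tails"
proof -
  have surj: "get ` states = carrier M \<times> tails" and inj: "inj_on get states"
    using get_bij by (simp_all add: bij_betw_def)
  show "x \<in> carrier M \<Longrightarrow> w \<in> tails \<Longrightarrow> get (put (x, w)) = (x, w)"
    using f_inv_into_f[of "(x, w)" get states] surj by (simp add: put_def)
  show "x \<in> carrier M \<Longrightarrow> w \<in> tails \<Longrightarrow> put (x, w) \<in> states"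
    using inv_into_into[of "(x, w)" get states] surj by (simp add: put_def)
  show "s \<in> states \<Longrightarrow> put (get s) = s"
    using inj by (simp add: put_def)
  show "s \<in> states \<Longrightarrow> get s \<in> carrier M \<times> tails"
    using surj by blast
qed

lemma get_act:
  assumes "x \<in> carrier M" "s \<in> states"
  shows "get (act x s) = (x \<otimes> fst (get s), snd (get s))"
proof -
  obtain y w where "get s = (y, w)" "y \<in> carrier M" "w \<in> tails" using get_closed[OF assms(2)] by auto
  then show ?thesis using assms(1) by (simp add: act_def get_put)
qed

lemma act_closed:
  assumes "x \<in> carrier M" "s \<in> states"
  shows "act x s \<in> states"
proof -
  obtain y w where "get s = (y, w)" "y \<in> carrier M" "w \<in> tails" using get_closed[OF assms(2)] by auto
  then show ?thesis using assms(1) by (simp add: act_def put_closed)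
qed

lemma act_one: "s \<in> states \<Longrightarrow> act \<one> s = s"
  using get_closed[of s] put_get[of s] by (auto simp: act_def)

lemma act_mult:
  assumes "x \<in> carrier M" "y \<in> carrier M" "s \<in> states"
  shows "act (x \<otimes> y) s = act x (act y s)"
proof -
  obtain z w where "get s = (z, w)" "z \<in> carrier M" using get_closed[OF assms(3)] by auto
  then show ?thesis
    unfolding act_def[of _ "act y s"] get_act[OF assms(2,3)] using assms by (simp add: act_def m_assoc)
qed

lemma act_amalgam:
  assumes n: "n \<in> carrier N" and s: "s \<in> states"
  shows "act (\<iota> n) s = (n \<otimes>\<^bsub>N\<^esub> fst s, snd s)"
proof -
  interpret N: monoid N by (rule monoid_N)
  obtain m r w where m: "m \<in> carrier N" "r \<in> reduced" "w \<in> tails" "s = (m, if r = \<one> then w else e r # w)"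
    using state_cases[OF s] by blast
  have "\<iota> n \<otimes> \<iota> m = \<iota> (n \<otimes>\<^bsub>N\<^esub> m)" using hom n m by (auto simp: monoid_hom_def hom_def)
  then have "(\<iota> n \<otimes> fst (get s), snd (get s)) = get (n \<otimes>\<^bsub>N\<^esub> m, if r = \<one> then w else e r # w)"
    using n m by (simp add: get_eq \<iota>_closed reduced_closed flip: m_assoc)
  then show ?thesis
    unfolding act_def using put_get[of "(n \<otimes>\<^bsub>N\<^esub> m, if r = \<one> then w else e r # w)"]
      state_closed[of "n \<otimes>\<^bsub>N\<^esub> m" r w] n m by simp
qed

lemma act_letter:
  assumes "e r # w \<in> V"
  shows "act r (\<one>\<^bsub>N\<^esub>, w) = (\<one>\<^bsub>N\<^esub>, e r # w)"
proof -
  interpret N: monoid N by (rule monoid_N)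
  have \<iota>1: "\<iota> \<one>\<^bsub>N\<^esub> = \<one>" using hom by (simp add: monoid_hom_def)
  have r: "r \<in> reduced" "r \<noteq> \<one>" "w \<in> tails" using assms by (auto simp: V_Cons tails_def)
  have "get (\<one>\<^bsub>N\<^esub>, w) = (\<one>, w)" "get (\<one>\<^bsub>N\<^esub>, e r # w) = (r, w)"
    using get_eq[of "\<one>\<^bsub>N\<^esub>" \<one> w] get_eq[of "\<one>\<^bsub>N\<^esub>" r w] r \<iota>1 one_reduced reduced_closed by auto
  then show ?thesis
    using put_get[of "(\<one>\<^bsub>N\<^esub>, e r # w)"] assms r reduced_closed
    by (simp add: act_def states_def)
qed

lemma act_inject:
  assumes "x \<in> carrier M" "y \<in> carrier M" "[] \<in> V" "act x (\<one>\<^bsub>N\<^esub>, []) = act y (\<one>\<^bsub>N\<^esub>, [])"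
  shows "x = y"
proof -
  interpret N: monoid N by (rule monoid_N)
  have s: "(\<one>\<^bsub>N\<^esub>, []) \<in> states" using assms(3) by (simp add: states_def)
  have "get (\<one>\<^bsub>N\<^esub>, []) = (\<one>, [])" using hom by (simp add: get_def monoid_hom_def)
  then have "get (act z (\<one>\<^bsub>N\<^esub>, [])) = (z, [])" if "z \<in> carrier M" for z
    using get_act[OF that s] that by simp
  from this[OF assms(1)] this[OF assms(2)] show ?thesis unfolding assms(4) by simp
qed

end

fun reduced_word :: "'a set \<Rightarrow> 'b set \<Rightarrow> ('a + 'b) list \<Rightarrow> bool"
  where
    "reduced_word S1 S2 [] \<longleftrightarrow> True"
  | "reduced_word S1 S2 (Inl r # w) \<longleftrightarrow> r \<in> S1 \<and> reduced_word S1 S2 w \<and> (\<forall>s v. w \<noteq> Inl s # v)"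
  | "reduced_word S1 S2 (Inr r # w) \<longleftrightarrow> r \<in> S2 \<and> reduced_word S1 S2 w \<and> (\<forall>s v. w \<noteq> Inr s # v)"

locale parabolic_amalgam =
  amalgam_data N M1 M2 i1 i2 +
  F1: parabolic_in_preGarside "i1 ` carrier N" M1 +
  F2: parabolic_in_preGarside "i2 ` carrier N" M2
  for N :: "('n, 'z) monoid_scheme" and M1 :: "('a, 'x) monoid_scheme"
    and M2 :: "('b, 'y) monoid_scheme" and i1 :: "'n \<Rightarrow> 'a" and i2 :: "'n \<Rightarrow> 'b" +
  assumes inj1: "inj_on i1 (carrier N)" and inj2: "inj_on i2 (carrier N)"
begin

definition "V = {w. reduced_word (F1.reduced - {\<one>\<^bsub>M1\<^esub>}) (F2.reduced - {\<one>\<^bsub>M2\<^esub>}) w}"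

sublocale a1: normal_form_action "i1 ` carrier N" M1 N i1 Inl V
  by unfold_locales (auto simp: V_def inj1 i1)

sublocale a2: normal_form_action "i2 ` carrier N" M2 N i2 Inr V
  by unfold_locales (auto simp: V_def inj2 i2)

abbreviation "states \<equiv> carrier N \<times> V"

lemma a1_states: "a1.states = states" and a2_states: "a2.states = states"
  by (simp_all add: a1.states_def a2.states_def)

definition act :: "'a + 'b \<Rightarrow> 'n \<times> ('a + 'b) list \<Rightarrow> 'n \<times> ('a + 'b) list"
  where "act c = case_sum a1.act a2.act c"

definition acts :: "('a + 'b) list \<Rightarrow> 'n \<times> ('a + 'b) list \<Rightarrow> 'n \<times> ('a + 'b) list"
  where "acts u = foldr act u"

lemma act_simps [simp]: "act (Inl x) = a1.act x" "act (Inr y) = a2.act y"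
  by (simp_all add: act_def)

lemma acts_simps [simp]:
  "acts [] s = s" "acts (c # u) s = act c (acts u s)" "acts (u @ v) s = acts u (acts v s)"
  by (simp_all add: acts_def)

lemma acts_closed: "u \<in> W \<Longrightarrow> s \<in> states \<Longrightarrow> acts u s \<in> states"
proof (induction u)
  case (Cons c u)
  then have "acts u s \<in> states" "c \<in> carrier M1 <+> carrier M2" by (auto simp: amalgam_words_def)
  then show ?case
    using a1.act_closed a2.act_closed unfolding a1_states a2_states by (cases c) auto
qed simp

text \<open>
  Both factors act, and on the common submonoid they both act by multiplying the first component;
  so all defining relations of the amalgam are respected.
\<close>

lemma acts_cong: "(u, v) \<in> C \<Longrightarrow> s \<in> states \<Longrightarrow> acts u s = acts v s"
proof (induction arbitrary: s rule: amalgam_cong.induct)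
  case (append u u' v v')
  then show ?case using acts_closed cong_words by (metis acts_simps(3))
next
  case one1
  then show ?case using a1.act_one unfolding a1_states by simp
next
  case one2
  then show ?case using a2.act_one unfolding a2_states by simp
next
  case (mult1 x y)
  then show ?case using a1.act_mult unfolding a1_states by simp
next
  case (mult2 x y)
  then show ?case using a2.act_mult unfolding a2_states by simp
next
  case (amalgam n)
  then show ?case using a1.act_amalgam a2.act_amalgam unfolding a1_states a2_states by simp
qed simp_all

lemma V_words: "w \<in> V \<Longrightarrow> w \<in> W"
proof (induction w)
  case (Cons c w)
  then show ?case
    by (cases c) (auto simp: V_def amalgam_words_def F1.reduced_def F2.reduced_def)
qed (simp add: amalgam_words_def)

lemma Nil_V: "[] \<in> V"
  by (simp add: V_def)

lemma acts_normal_form: "w \<in> V \<Longrightarrow> acts w (\<one>\<^bsub>N\<^esub>, []) = (\<one>\<^bsub>N\<^esub>, w)"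
proof (induction w)
  case (Cons c w)
  then have "w \<in> V" by (cases c) (auto simp: V_def)
  then show ?case
    using Cons a1.act_letter a2.act_letter by (cases c) auto
qed simp

text \<open>
  A normal form is recovered from the element it represents by applying it to the empty state.
\<close>

lemma normal_form_unique:
  assumes "n \<in> carrier N" "m \<in> carrier N" "w \<in> V" "v \<in> V"
    and "C `` {Inl (i1 n) # w} = C `` {Inl (i1 m) # v}"
  shows "n = m \<and> w = v"
proof -
  have *: "acts (Inl (i1 n) # w) (\<one>\<^bsub>N\<^esub>, []) = (n, w)" if "n \<in> carrier N" "w \<in> V" for n w
    using that a1.act_amalgam[of n "(\<one>\<^bsub>N\<^esub>, w)"] unfolding a1_states by (simp add: acts_normal_form)
  have "Inl (i1 n) # w \<in> W" "Inl (i1 m) # v \<in> W"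
    using assms V_words i1_closed by (auto simp: amalgam_words_def)
  then have "(Inl (i1 n) # w, Inl (i1 m) # v) \<in> C" using assms(5) class_eq_iff by blast
  from acts_cong[OF this, of "(\<one>\<^bsub>N\<^esub>, [])"] show ?thesis
    using * assms Nil_V by simp
qed

text \<open>
  The factors embed in the amalgam because \<open>x\<close> can be read off from its effect on the empty state.
\<close>

lemma inj_j1: "inj_on j1 (carrier M1)"
proof (rule inj_onI)
  fix x y assume xy: "x \<in> carrier M1" "y \<in> carrier M1" "j1 x = j1 y"
  then have "([Inl x], [Inl y]) \<in> C"
    using class_eq_iff inl_word unfolding amalgam_inj1_def by blast
  from acts_cong[OF this, of "(\<one>\<^bsub>N\<^esub>, [])"] show "x = y"
    using a1.act_inject xy Nil_V by simp
qed

lemma inj_j2: "inj_on j2 (carrier M2)"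
proof (rule inj_onI)
  fix x y assume xy: "x \<in> carrier M2" "y \<in> carrier M2" "j2 x = j2 y"
  then have "([Inr x], [Inr y]) \<in> C"
    using class_eq_iff inr_word unfolding amalgam_inj2_def by blast
  from acts_cong[OF this, of "(\<one>\<^bsub>N\<^esub>, [])"] show "x = y"
    using a2.act_inject xy Nil_V by simp
qed

end

section \<open>The amalgamated product and its opposite\<close>

lemma parabolic_in_preGarside_image:
  assumes "parabolic_in_preGarside H M" "monoid K" and h: "h \<in> monoid_hom M K" "inj_on h (carrier M)"
  shows "parabolic_in_preGarside (h ` H) (K\<lparr>carrier := h ` carrier M\<rparr>)" (is "parabolic_in_preGarside _ ?K")
    and "parabolic_in_preGarside.reduced (h ` H) (K\<lparr>carrier := h ` carrier M\<rparr>) - {\<one>\<^bsub>K\<^esub>}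
      \<subseteq> h ` (parabolic_in_preGarside.reduced H M - {\<one>\<^bsub>M\<^esub>})"
proof -
  interpret M: parabolic_in_preGarside H M by fact
  interpret K: monoid K by fact
  have hc: "h x \<in> carrier K" if "x \<in> carrier M" for x using that h by (auto simp: monoid_hom_def hom_def)
  have hm: "h (x \<otimes>\<^bsub>M\<^esub> y) = h x \<otimes>\<^bsub>K\<^esub> h y" if "x \<in> carrier M" "y \<in> carrier M" for x y
    using that h by (auto simp: monoid_hom_def hom_def)
  have h1: "h \<one>\<^bsub>M\<^esub> = \<one>\<^bsub>K\<^esub>" using h by (simp add: monoid_hom_def)
  have "monoid ?K"
  proof (rule monoidI)
    show "\<one>\<^bsub>?K\<^esub> \<in> carrier ?K" using imageI[of "\<one>\<^bsub>M\<^esub>" "carrier M" h] h1 by simp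
    show "x \<otimes>\<^bsub>?K\<^esub> y \<in> carrier ?K" if "x \<in> carrier ?K" "y \<in> carrier ?K" for x y
      using that by (auto simp flip: hm)
  qed (auto simp: hc K.m_assoc)
  moreover have "h \<in> iso M ?K" using h by (auto simp: iso_def hom_def monoid_hom_def bij_betw_def)
  ultimately show 1: "parabolic_in_preGarside (h ` H) ?K"
    using preGarside_monoid_iso[of M ?K h] parabolic_submonoid_iso[of H M ?K h] h1
      M.preGarside_monoid_axioms M.parabolic_submonoid_axioms M.monoid_axioms
    by (simp add: parabolic_in_preGarside.intro)
  show "parabolic_in_preGarside.reduced (h ` H) ?K - {\<one>\<^bsub>K\<^esub>} \<subseteq> h ` (M.reduced - {\<one>\<^bsub>M\<^esub>})"
  proof
    fix r assume r: "r \<in> parabolic_in_preGarside.reduced (h ` H) ?K - {\<one>\<^bsub>K\<^esub>}"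
    then obtain x where x: "x \<in> carrier M" "r = h x"
      by (auto simp: parabolic_in_preGarside.reduced_def[OF 1])
    have "n = \<one>\<^bsub>M\<^esub>" if n: "n \<in> H" "n divides\<^bsub>M\<^esub> x" for n
    proof -
      obtain c where "c \<in> carrier M" "x = n \<otimes>\<^bsub>M\<^esub> c" using n by (auto simp: factor_def)
      then have "c \<in> carrier M" "r = h n \<otimes>\<^bsub>K\<^esub> h c" using x hm M.in_carrier[OF n(1)] by simp_all
      then have "h n divides\<^bsub>?K\<^esub> r" by (simp add: factor_def) blast
      moreover have "\<forall>m\<in>h ` H. m divides\<^bsub>?K\<^esub> r \<longrightarrow> m = \<one>\<^bsub>K\<^esub>"
        using r by (simp add: parabolic_in_preGarside.reduced_def[OF 1])
      ultimately have "h n = h \<one>\<^bsub>M\<^esub>" using n(1) h1 by simp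
      then show ?thesis using inj_onD[OF h(2)] M.in_carrier[OF n(1)] by simp
    qed
    then have "x \<in> M.reduced" using x by (simp add: M.reduced_def)
    moreover have "x \<noteq> \<one>\<^bsub>M\<^esub>" using r x h1 by auto
    ultimately show "r \<in> h ` (M.reduced - {\<one>\<^bsub>M\<^esub>})" using x by blast
  qed
qed

context parabolic_amalgam
begin

definition "side i = (if i then j1 ` carrier M1 else j2 ` carrier M2)"

definition "common = j1 ` i1 ` carrier N"

lemma common_eq: "common = j2 ` i2 ` carrier N"
  unfolding common_def using amalgamated_product_cocone(3) by (simp add: image_image cong: image_cong)

lemma factor: "parabolic_in_preGarside common (P\<lparr>carrier := side i\<rparr>)"
proof (cases i)
  case True
  then show ?thesis
    using parabolic_in_preGarside_image(1)[OF F1.parabolic_in_preGarside_axioms monoid_amalgamated_product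
      amalgamated_product_cocone(1) inj_j1] by (simp add: side_def common_def)
next
  case False
  then show ?thesis
    using parabolic_in_preGarside_image(1)[OF F2.parabolic_in_preGarside_axioms monoid_amalgamated_product
      amalgamated_product_cocone(2) inj_j2] by (simp add: side_def common_eq)
qed

definition "letters i = parabolic_in_preGarside.reduced common (P\<lparr>carrier := side i\<rparr>) - {\<one>\<^bsub>P\<^esub>}"

lemma letters_True: "r \<in> letters True \<Longrightarrow> \<exists>x\<in>F1.reduced - {\<one>\<^bsub>M1\<^esub>}. r = j1 x"
  using parabolic_in_preGarside_image(2)[OF F1.parabolic_in_preGarside_axioms monoid_amalgamated_product
      amalgamated_product_cocone(1) inj_j1]
  by (auto simp: letters_def side_def common_def)

lemma letters_False: "r \<in> letters False \<Longrightarrow> \<exists>x\<in>F2.reduced - {\<one>\<^bsub>M2\<^esub>}. r = j2 x"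
  using parabolic_in_preGarside_image(2)[OF F2.parabolic_in_preGarside_axioms monoid_amalgamated_product
      amalgamated_product_cocone(2) inj_j2]
  by (auto simp: letters_def side_def common_eq)

text \<open>
  Words over the images of the factors in \<open>P\<close> are images of words over the disjoint union of the
  factors, for which uniqueness is already known.
\<close>

lemma alternating_lift:
  assumes "alternating letters i w"
  shows "\<exists>u\<in>V. w = map (\<lambda>c. (isl c, C `` {[c]})) u \<and> word_product P w = C `` {u}"
  using assms
proof (induction w arbitrary: i)
  case Nil
  then show ?case by (auto simp: Nil_V one_eq intro!: bexI[of _ "[]"])
next
  case (Cons p w)
  then obtain r where r: "p = (i, r)" "r \<in> letters i" "alternating letters (\<not> i) w" by (cases p) auto
  obtain u where u: "u \<in> V" "w = map (\<lambda>c. (isl c, C `` {[c]})) u" "word_product P w = C `` {u}"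
    using Cons.IH[OF r(3)] by blast
  \<comment> \<open>The word \<open>u\<close> does not begin on side \<open>i\<close>.\<close>
  have hd: "isl c = (\<not> i)" if "u = c # v" for c v using r(3) u(2) that by auto
  obtain c where c: "isl c = i" "r = C `` {[c]}" "c # u \<in> V"
  proof (cases i)
    case True
    then obtain x where "x \<in> F1.reduced - {\<one>\<^bsub>M1\<^esub>}" "r = j1 x" using letters_True r by auto
    then show thesis using that[of "Inl x"] True u(1) hd unfolding V_def amalgam_inj1_def by force
  next
    case False
    then obtain x where "x \<in> F2.reduced - {\<one>\<^bsub>M2\<^esub>}" "r = j2 x" using letters_False r by auto
    then show thesis using that[of "Inr x"] False u(1) hd unfolding V_def amalgam_inj2_def by force
  qed
  have "[c] \<in> W" "u \<in> W" using V_words[OF c(3)] by (auto simp: amalgam_words_def)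
  then have "r \<otimes>\<^bsub>P\<^esub> C `` {u} = C `` {c # u}" using mult_class[of "[c]" u] c by simp
  then show ?case using c u r by (intro bexI[of _ "c # u"]) auto
qed

lemma amalgam_of_submonoids: "amalgam_of_submonoids P side common"
proof -
  interpret P: monoid P by (rule monoid_amalgamated_product)
  have j: "j1 x \<in> carrier P" if "x \<in> carrier M1" for x
    using that by (simp add: amalgam_inj1_def class_closed inl_word)
  have j': "j2 x \<in> carrier P" if "x \<in> carrier M2" for x
    using that by (simp add: amalgam_inj2_def class_closed inr_word)
  show ?thesis
  proof (intro amalgam_of_submonoids.intro amalgam_of_submonoids_axioms.intro)
    show "monoid P" ..
  next
    show "side i \<subseteq> carrier P" for i using j j' by (auto simp: side_def)
  next
    show "parabolic_in_preGarside common (P\<lparr>carrier := side i\<rparr>)" for i by (rule factor)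
  next
    fix Q
    assume Q: "\<one>\<^bsub>P\<^esub> \<in> Q" "\<And>i x b. \<lbrakk>x \<in> side i; b \<in> Q\<rbrakk> \<Longrightarrow> x \<otimes>\<^bsub>P\<^esub> b \<in> Q"
    have "C `` {u} \<in> Q" if "u \<in> W" for u
      using that
    proof (induction u)
      case Nil
      then show ?case using Q(1) by (simp add: one_eq)
    next
      case (Cons c u)
      then have cu: "[c] \<in> W" "u \<in> W" by (auto simp: amalgam_words_def)
      have "C `` {[c]} \<in> side (isl c)"
        using cu by (cases c) (auto simp: side_def amalgam_words_def amalgam_inj1_def amalgam_inj2_def)
      then have "C `` {[c]} \<otimes>\<^bsub>P\<^esub> C `` {u} \<in> Q" using Q(2) Cons.IH cu by blast
      then show ?case using mult_class[OF cu] by simp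
    qed
    then show "carrier P \<subseteq> Q" using carrierE by blast
  next
    fix n m i w j v
    assume "n \<in> common" "m \<in> common"
      and w: "alternating (\<lambda>i. parabolic_in_preGarside.reduced common (P\<lparr>carrier := side i\<rparr>) - {\<one>\<^bsub>P\<^esub>}) i w"
      and v: "alternating (\<lambda>i. parabolic_in_preGarside.reduced common (P\<lparr>carrier := side i\<rparr>) - {\<one>\<^bsub>P\<^esub>}) j v"
      and eq: "n \<otimes>\<^bsub>P\<^esub> word_product P w = m \<otimes>\<^bsub>P\<^esub> word_product P v"
    then obtain n' m' where n: "n' \<in> carrier N" "n = j1 (i1 n')" and m: "m' \<in> carrier N" "m = j1 (i1 m')"
      by (auto simp: common_def)
    obtain w' where w': "w' \<in> V" "w = map (\<lambda>c. (isl c, C `` {[c]})) w'" "word_product P w = C `` {w'}"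
      using alternating_lift w unfolding letters_def[abs_def] by blast
    obtain v' where v': "v' \<in> V" "v = map (\<lambda>c. (isl c, C `` {[c]})) v'" "word_product P v = C `` {v'}"
      using alternating_lift v unfolding letters_def[abs_def] by blast
    have mult: "j1 (i1 n) \<otimes>\<^bsub>P\<^esub> C `` {w} = C `` {Inl (i1 n) # w}" if "n \<in> carrier N" "w \<in> V" for n w
      using mult_class[of "[Inl (i1 n)]" w] that V_words inl_word i1_closed by (simp add: amalgam_inj1_def)
    have "C `` {Inl (i1 n') # w'} = C `` {Inl (i1 m') # v'}"
      using eq mult n m w' v' by simp
    then show "n = m \<and> w = v" using normal_form_unique n m w' v' by blast
  qed
qed

lemma left_preGarside: "left_preGarside_monoid P"
  by (rule amalgam_of_submonoids.left_preGarside[OF amalgam_of_submonoids])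

end

text \<open>
  Stated for monoids with mutually opposite multiplications, not for \<open>opposite\<close> itself, so
  that it applies in both directions: \<open>opposite (opposite M)\<close> is a truncation of \<open>M\<close>, not \<open>M\<close>.
\<close>

lemma amalgam_cong_rev:
  assumes "carrier N' = carrier N" "carrier M1' = carrier M1" "carrier M2' = carrier M2"
    and "\<one>\<^bsub>M1'\<^esub> = \<one>\<^bsub>M1\<^esub>" "\<one>\<^bsub>M2'\<^esub> = \<one>\<^bsub>M2\<^esub>"
    and "\<And>x y. x \<otimes>\<^bsub>M1\<^esub> y = y \<otimes>\<^bsub>M1'\<^esub> x" "\<And>x y. x \<otimes>\<^bsub>M2\<^esub> y = y \<otimes>\<^bsub>M2'\<^esub> x"
    and "(u, v) \<in> amalgam_cong N i1 M1 i2 M2"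
  shows "(rev u, rev v) \<in> amalgam_cong N' i1 M1' i2 M2'"
  using assms(8)
proof (induction rule: amalgam_cong.induct)
  case (refl u)
  then show ?case using assms by (intro amalgam_cong.refl) (auto simp: amalgam_words_def)
next
  case (sym u v)
  show ?case using sym.IH by (rule amalgam_cong.sym)
next
  case (trans u v w)
  show ?case using trans.IH by (rule amalgam_cong.trans)
next
  case (append u u' v v')
  then show ?case by (simp add: amalgam_cong.append)
next
  case one1
  then show ?case using amalgam_cong.one1[of M1'] assms by simp
next
  case one2
  then show ?case using amalgam_cong.one2[of M2'] assms by simp
next
  case (mult1 x y)
  then show ?case using amalgam_cong.mult1[of y M1' x] assms by simp
next
  case (mult2 x y)
  then show ?case using amalgam_cong.mult2[of y M2' x] assms by simp
next
  case (amalgam n)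
  then show ?case using amalgam_cong.amalgam[of n N'] assms by simp
qed

lemma monoid_hom_opposite: "h \<in> monoid_hom M K \<Longrightarrow> h \<in> monoid_hom (opposite M) (opposite K)"
  by (auto simp: monoid_hom_def hom_def)

lemma (in amalgam_data) opposite_amalgamated_product_iso:
  "(`) rev \<in> iso (amalgamated_product (opposite N) i1 (opposite M1) i2 (opposite M2)) (opposite P)"
proof -
  interpret op: amalgam_data "opposite N" "opposite M1" "opposite M2" i1 i2
    by (intro amalgam_data.intro amalgam_data_axioms.intro)
      (use i1 i2 in \<open>simp_all add: N.monoid_opposite M1.monoid_opposite M2.monoid_opposite monoid_hom_opposite\<close>)
  have W: "op.W = W" by (simp add: amalgam_words_def)
  have cong: "(u, v) \<in> op.C \<longleftrightarrow> (rev u, rev v) \<in> C" for u v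
  proof
    show "(rev u, rev v) \<in> C" if "(u, v) \<in> op.C"
      by (rule amalgam_cong_rev[OF _ _ _ _ _ _ _ that]) simp_all
    show "(u, v) \<in> op.C" if "(rev u, rev v) \<in> C"
    proof -
      have "(rev (rev u), rev (rev v)) \<in> op.C"
        by (rule amalgam_cong_rev[OF _ _ _ _ _ _ _ that]) simp_all
      then show ?thesis by simp
    qed
  qed
  have class_rev: "rev ` (op.C `` {u}) = C `` {rev u}" for u
  proof (intro equalityI subsetI)
    fix v assume "v \<in> C `` {rev u}"
    then have "rev v \<in> op.C `` {u}" by (simp add: cong)
    then show "v \<in> rev ` (op.C `` {u})" by (metis image_eqI rev_rev_ident)
  qed (auto simp: cong)
  have rev_W: "rev u \<in> W \<longleftrightarrow> u \<in> W" for u by (simp add: amalgam_words_def in_lists_conv_set)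
  show ?thesis
    unfolding iso_def hom_def
  proof (intro CollectI conjI ballI)
    show "(`) rev \<in> carrier op.P \<rightarrow> carrier (opposite P)"
    proof
      fix X assume "X \<in> carrier op.P"
      then obtain u where "u \<in> W" "X = op.C `` {u}" unfolding W[symmetric] by (rule op.carrierE)
      then show "rev ` X \<in> carrier (opposite P)" by (simp add: class_rev class_closed rev_W)
    qed
  next
    fix X Y assume X: "X \<in> carrier op.P" and Y: "Y \<in> carrier op.P"
    obtain u where u: "u \<in> W" "X = op.C `` {u}" using X unfolding W[symmetric] by (rule op.carrierE)
    obtain v where v: "v \<in> W" "Y = op.C `` {v}" using Y unfolding W[symmetric] by (rule op.carrierE)
    show "rev ` (X \<otimes>\<^bsub>op.P\<^esub> Y) = rev ` X \<otimes>\<^bsub>opposite P\<^esub> rev ` Y"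
      using u v by (simp add: op.mult_class W class_rev mult_class rev_W)
  next
    show "bij_betw ((`) rev) (carrier op.P) (carrier (opposite P))"
      unfolding bij_betw_def
    proof (intro conjI)
      show "inj_on ((`) rev) (carrier op.P)" by (rule inj_onI) (simp add: inj_image_eq_iff)
      show "(`) rev ` carrier op.P = carrier (opposite P)"
      proof (intro equalityI subsetI)
        fix X assume "X \<in> carrier (opposite P)"
        then have "X \<in> carrier P" by simp
        then obtain u where u: "u \<in> W" "X = C `` {u}" by (rule carrierE)
        then have "X = rev ` (op.C `` {rev u})" by (simp add: class_rev)
        moreover have "op.C `` {rev u} \<in> carrier op.P" using op.class_closed[of "rev u"] W rev_W u by simp
        ultimately show "X \<in> (`) rev ` carrier op.P" by blast
      next
        fix X assume "X \<in> (`) rev ` carrier op.P"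
        then obtain Y where Y: "Y \<in> carrier op.P" "X = rev ` Y" by blast
        obtain u where "u \<in> W" "Y = op.C `` {u}" using Y(1) unfolding W[symmetric] by (rule op.carrierE)
        then have "u \<in> W" "X = rev ` (op.C `` {u})" using Y(2) by simp_all
        then show "X \<in> carrier (opposite P)" by (simp add: class_rev class_closed rev_W)
      qed
    qed
  qed
qed

theorem proposition3p11:
  fixes M1 :: "('a, 'x) monoid_scheme" and M2 :: "('b, 'y) monoid_scheme"
    and N :: "('n, 'z) monoid_scheme"
    and \<iota>1 :: "'n \<Rightarrow> 'a" and \<iota>2 :: "'n \<Rightarrow> 'b"
  assumes "preGarside_monoid M1" and "preGarside_monoid M2" and "monoid N"
    and "\<iota>1 \<in> monoid_hom N M1" and "inj_on \<iota>1 (carrier N)"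
    and "\<iota>2 \<in> monoid_hom N M2" and "inj_on \<iota>2 (carrier N)"
    and "parabolic_submonoid (\<iota>1 ` carrier N) M1"
    and "parabolic_submonoid (\<iota>2 ` carrier N) M2"
  shows "preGarside_monoid (amalgamated_product N \<iota>1 M1 \<iota>2 M2)"
proof -
  interpret M1: parabolic_in_preGarside "\<iota>1 ` carrier N" M1
    using assms(1,8) by (rule parabolic_in_preGarside.intro)
  interpret M2: parabolic_in_preGarside "\<iota>2 ` carrier N" M2
    using assms(2,9) by (rule parabolic_in_preGarside.intro)
  interpret N: monoid N by fact
  interpret parabolic_amalgam N M1 M2 \<iota>1 \<iota>2
    by unfold_locales (fact assms)+
  have op: "parabolic_amalgam (opposite N) (opposite M1) (opposite M2) \<iota>1 \<iota>2"
    using M1.opposite M2.opposite N.monoid_opposite assms(4-7)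
    by (auto intro!: parabolic_amalgam.intro amalgam_data.intro parabolic_amalgam_axioms.intro
        amalgam_data_axioms.intro monoid_hom_opposite M1.monoid_opposite M2.monoid_opposite)
  have "left_preGarside_monoid (opposite P)"
    using parabolic_amalgam.left_preGarside[OF op]
      monoid.monoid_opposite[OF monoid_amalgamated_product] opposite_amalgamated_product_iso
    by (rule left_preGarside_monoid_iso)
  then show ?thesis using left_preGarside by (simp add: preGarside_monoid_iff)
qed

end
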